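(* Let $d\ge 2$. There exists a constant $K>0$, depending only on $d$ (in particular independent of $n$ and $p$), such that the following holds. Let $p\in[1,\infty]$, let $\lambda=\lambda(n)>0$ be a sequence in the connectivity regime for $(d,p)$ with $\lambda(n)\to 0$, and let $G=G_p^d(\lambda(n),n)$ be the unit ball random geometric graph with vertex set $V_n=\{v_1,\dots,v_n\}$. Then for any two vertices $x=v_i$, $y=v_j$ of $V_n$ ($i\ne j$), as $n\to\infty$, almost always, $$d_G(x,y)\ \le\ \frac{K\,\|x-y\|_2}{\lambda}.$$
   Context: $\mathbf{B}=\{x\in\mathbb{R}^d:\|x\|_2\le 1\}$ is the Euclidean unit ball; $\|\cdot\|_p$ is the $\ell_p$-norm on $\mathbb{R}^d$ ($\max$-norm for $p=\infty$). The unit ball random geometric graph $G_p^d(\lambda,n)$ has as vertex set $V_n$ a set of $n$ points distributed independently and uniformly (with respect to Lebesgue measure) in $\mathbf{B}$; two vertices $x,y$ are adjacent if and only if $\|x-y\|_p\le\lambda$. The graph distance $d_G(x,y)$ is the length (number of edges) of a shortest path from $x$ to $y$, or $\infty$ if there is none. A property holds almost always if its probability tends to $1$ as $n\to\infty$. Let $\alpha=\alpha_p^d=\operatorname{vol}\{x\in\mathbb{R}^d:\|x\|_p\le 1\}/\operatorname{vol}(\mathbf{B})$. For $d\ge2$, a sequence $\lambda=\lambda(n)$ is in the connectivity regime for $(d,p)$ if at least one of the following holds: (i) $p\in(1,\infty]$ and $\lambda(n)\ge\left(\frac{1}{\alpha n}\left(\frac{2(d-1)}{d}\ln n+\frac{2}{d}\ln\ln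 n+\gamma(n)\right)\right)^{1/d}$ for some nonnegative sequence $\gamma(n)\to\infty$; (ii) $p\in[1,\infty]$ and $\lambda(n)=(c\ln n/n)^{1/d}$ for some constant $c>2(d-1)/(d\alpha)$. (Inequalities involving $\ln\ln n$ are for all sufficiently large $n$.) *)

theory Defs
  imports
    "HOL-Probability.Probability"
    "Graph_Theory.Pair_Digraph"
    "Graph_Theory.Shortest_Path"
begin

text \<open>The exponent of the norm is an extended real, meant to satisfy \<open>1 \<le> p\<close>; on \<^typ>\<open>real ^ 'd\<close>
  the library constant \<^const>\<open>infnorm\<close> is the maximum of the absolute values of the coordinates.\<close>

definition lp_norm :: "ereal \<Rightarrow> real ^ 'd \<Rightarrow> real" where
  "lp_norm p x =
     (if p = \<infinity> then infnorm x
      else (\<Sum>k\<in>UNIV. \<bar>x $ k\<bar> powr real_of_ereal p) powr (1 / real_of_ereal p))"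

definition lp_ball_ratio :: "'d::finite itself \<Rightarrow> ereal \<Rightarrow> real" where
  "lp_ball_ratio _ p =
     measure lborel {x :: real ^ 'd. lp_norm p x \<le> 1} / measure lborel (cball (0 :: real ^ 'd) 1)"

definition random_points :: "nat \<Rightarrow> (nat \<Rightarrow> real ^ 'd) measure" where
  "random_points n = PiM {1..n} (\<lambda>_. uniform_measure lborel (cball 0 1))"

text \<open>A simple graph is a symmetric loop-free digraph (locale \<^locale>\<open>pair_graph\<close>).\<close>

definition geometric_graph :: "ereal \<Rightarrow> real \<Rightarrow> (real ^ 'd) set \<Rightarrow> (real ^ 'd) pair_pre_digraph" where
  "geometric_graph p r V =
     \<lparr> pverts = V, parcs = {(x, y). x \<in> V \<and> y \<in> V \<and> x \<noteq> y \<and> lp_norm p (x - y) \<le> r} \<rparr>"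

definition graph_dist :: "'a pair_pre_digraph \<Rightarrow> 'a \<Rightarrow> 'a \<Rightarrow> ereal" where
  "graph_dist G x y = wf_digraph.\<mu> (with_proj G) (\<lambda>_. 1) x y"

lemma lp_norm_minus: "lp_norm p (- x) = lp_norm p x"
  by (simp add: lp_norm_def infnorm_neg)

lemma pair_graph_geometric_graph:
  assumes "finite V"
  shows "pair_graph (geometric_graph p r V)"
proof
  have "parcs (geometric_graph p r V) \<subseteq> V \<times> V"
    by (auto simp: geometric_graph_def)
  then show "finite (parcs (geometric_graph p r V))"
    using assms finite_subset by blast
  show "symmetric (with_proj (geometric_graph p r V))"
    unfolding symmetric_def with_proj_simps
  proof (rule symI)
    fix x y assume "(x, y) \<in> parcs (geometric_graph p r V)"
    then show "(y, x) \<in> parcs (geometric_graph p r V)"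
      using lp_norm_minus[of p "x - y"] by (auto simp: geometric_graph_def)
  qed
qed (use assms in \<open>auto simp: geometric_graph_def\<close>)

lemma (in pair_wf_digraph) graph_dist_eq:
  "graph_dist G x y = (INF w\<in>{w. awalk x w y}. ereal (length w))"
proof -
  have "awalk_cost (\<lambda>_. 1) w = length w" for w :: "('a \<times> 'a) list"
    by (induction w) simp_all
  then show ?thesis
    unfolding graph_dist_def \<mu>_def by simp
qed

text \<open>The inequalities are only required for large \<open>n\<close>: in the first case \<open>ln (ln n)\<close> is not
  meaningful for small \<open>n\<close>, and in the second case the right-hand side vanishes at \<open>n = 1\<close>.\<close>

definition connectivity_regime :: "'d::finite itself \<Rightarrow> ereal \<Rightarrow> (nat \<Rightarrow> real) \<Rightarrow> bool" where
  "connectivity_regime D p r \<longleftrightarrow>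
     (let d = real CARD('d); \<alpha> = lp_ball_ratio D p in
       1 < p \<and>
         (\<exists>\<gamma>. (\<forall>n. 0 \<le> \<gamma> n) \<and> filterlim \<gamma> at_top sequentially \<and>
           (\<forall>\<^sub>F n in sequentially.
             r n \<ge> (1 / (\<alpha> * real n) *
               (2 * (d - 1) / d * ln (real n) + 2 / d * ln (ln (real n)) + \<gamma> n)) powr (1 / d))) \<or>
       1 \<le> p \<and>
         (\<exists>c > 2 * (d - 1) / (d * \<alpha>).
           \<forall>\<^sub>F n in sequentially. r n = (c * ln (real n) / real n) powr (1 / d)))"

end

theory Submission
  imports Defs "HOL-Real_Asymp.Real_Asymp"
begin

text \<open>
The two vertices are fixed in advance, so they behave like two independent uniform points: with
probability tending to 1 they are far from the boundary of the ball on the scale of \<open>r\<close>, and at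
distance at least \<open>r / (2 d)\<close> from each other. Hence the boundary, which governs the exact
connectivity threshold, stays out of sight. The regime gives \<open>r ^ d \<ge> const * ln n / n\<close>
eventually, with a constant depending on \<open>d\<close> only (\<open>connectivity_regime_volume_ge\<close>).

Space is divided into cubic cells of side \<open>s = r / (2 d)\<close>; points in neighbouring cells are
adjacent for every \<open>p\<close>. A cell has mass \<open>w \<ge> c * ln n / n\<close> with \<open>c > 0\<close> depending on \<open>d\<close> only. As
\<open>c\<close> may be much smaller than 1, many cells are empty and the cells along the segment from \<open>x\<close> to
\<open>y\<close> cannot all be expected to be occupied. But \<open>M\<close> given cells are all empty with probability at
most \<open>n powr (- c * M)\<close>, and the number of cells in the ball is at most of order \<open>n / ln n\<close>. For a large
constant \<open>M\<close> a union bound therefore shows that, with probability tending to 1, every window of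
\<open>N \<times> N\<close> cells inside the ball, \<open>N = 2 M\<close>, contains fewer than \<open>M\<close> empty cells
(\<open>prob_window_with_many_empty_cells\<close>).

This is enough for a path of the right length. Each window has a fully occupied column, and the
windows at two neighbouring cells have a fully occupied row in common, so a path can be led
through the windows along the segment with at most \<open>2 N + 1\<close> hops per window
(\<open>relpow_through_windows\<close>, \<open>hop_path_along_segment\<close>). To attach \<open>x\<close> and \<open>y\<close> it suffices that
their own windows have no empty cell at all, and for two given points this holds with probability
tending to 1 (\<open>prob_own_window_not_full\<close>). The number of windows is of order
\<open>norm (x - y) / r\<close>, and \<open>N\<close> depends on \<open>d\<close> only, which gives \<open>K\<close>.
\<close>

section \<open>The \<open>p\<close>-norms and the connectivity regime\<close>

lemma lp_norm_le_of_components: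
  fixes x :: "real ^ 'd::finite"
  assumes "1 \<le> p" and x: "\<And>k. \<bar>x $ k\<bar> \<le> t / CARD('d)" and "0 \<le> t"
  shows "lp_norm p x \<le> t"
proof (cases "p = \<infinity>")
  case True
  have "t / CARD('d) \<le> t / 1"
    using \<open>0 \<le> t\<close> by (intro divide_left_mono) (auto simp: Suc_le_eq)
  then have "\<bar>x $ k\<bar> \<le> t" for k
    using x[of k] by simp
  then have "infnorm x \<le> t"
    unfolding infnorm_cart by (intro cSup_least) auto
  with True show ?thesis
    by (simp add: lp_norm_def)
next
  case False
  then obtain q where q: "p = ereal q" "1 \<le> q"
    using \<open>1 \<le> p\<close> by (cases p) auto
  have "(\<Sum>k\<in>UNIV. \<bar>x $ k\<bar> powr q) \<le> (\<Sum>k\<in>(UNIV::'d set). (t / CARD('d)) powr q)"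
    using x q by (intro sum_mono powr_mono2) auto
  also have "\<dots> = t powr q * (real CARD('d) * (1 / CARD('d)) powr q)"
    using \<open>0 \<le> t\<close> by (simp add: powr_divide)
  also have "\<dots> \<le> t powr q * (real CARD('d) * (1 / CARD('d)) powr 1)"
    using q by (intro mult_left_mono powr_mono') (auto simp: Suc_le_eq)
  finally have "(\<Sum>k\<in>UNIV. \<bar>x $ k\<bar> powr q) \<le> t powr q"
    by simp
  then have "(\<Sum>k\<in>UNIV. \<bar>x $ k\<bar> powr q) powr (1 / q) \<le> (t powr q) powr (1 / q)"
    using q by (intro powr_mono2 sum_nonneg) auto
  also have "\<dots> = t"
    using q \<open>0 \<le> t\<close> by (simp add: powr_powr)
  finally show ?thesis
    using q by (simp add: lp_norm_def)
qed

lemma component_le_lp_norm: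
  fixes x :: "real ^ 'd::finite"
  assumes "1 \<le> p"
  shows "\<bar>x $ k\<bar> \<le> lp_norm p x"
proof (cases "p = \<infinity>")
  case True
  then show ?thesis
    by (simp add: lp_norm_def component_le_infnorm_cart)
next
  case False
  then obtain q where q: "p = ereal q" "1 \<le> q"
    using \<open>1 \<le> p\<close> by (cases p) auto
  have "\<bar>x $ k\<bar> = (\<bar>x $ k\<bar> powr q) powr (1 / q)"
    using q by (simp add: powr_powr)
  also have "\<dots> \<le> (\<Sum>k\<in>UNIV. \<bar>x $ k\<bar> powr q) powr (1 / q)"
    using q by (intro powr_mono2 member_le_sum) auto
  finally show ?thesis
    using q by (simp add: lp_norm_def)
qed

lemma borel_measurable_lp_norm [measurable]:
  "(lp_norm p :: real ^ 'd::finite \<Rightarrow> real) \<in> borel_measurable borel"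
proof -
  have "(infnorm :: real ^ 'd \<Rightarrow> real) \<in> borel_measurable borel"
    by (intro borel_measurable_continuous_onI continuous_intros)
  moreover have "(\<lambda>x :: real ^ 'd. (\<Sum>k\<in>UNIV. \<bar>x $ k\<bar> powr real_of_ereal p) powr
      (1 / real_of_ereal p)) \<in> borel_measurable borel"
    by measurable
  ultimately show ?thesis
    by (cases "p = \<infinity>") (simp_all add: lp_norm_def[abs_def])
qed

text \<open>The unit ball of the \<open>p\<close>-norm lies between the cubes with half-sides \<open>1 / d\<close> and \<open>1\<close>. Strict
positivity excludes the degenerate reading of a division by \<open>\<alpha> = 0\<close>.\<close>

lemma lp_ball_ratio_bounds:
  assumes "1 \<le> p"
  defines "\<omega> \<equiv> unit_ball_vol (real CARD('d::finite))"
  shows "0 < lp_ball_ratio TYPE('d) p" and "lp_ball_ratio TYPE('d) p \<le> 2 ^ CARD('d) / \<omega>"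
proof -
  let ?d = "real CARD('d)"
  let ?L = "{x :: real ^ 'd. lp_norm p x \<le> 1}"
  let ?C = "\<lambda>t. cbox (\<chi> k. - t) (\<chi> k. t) :: (real ^ 'd) set"
  have L: "?L \<in> sets lborel"
    by measurable
  have C: "measure lborel (?C t) = (2 * t) ^ CARD('d)" if "0 \<le> t" for t
    using that by (subst content_cbox_cart) (auto simp: interval_ne_empty_cart)
  have C_sets: "?C t \<in> fmeasurable lborel" for t
    by (simp add: fmeasurable_cbox)
  have "?L \<subseteq> ?C 1"
  proof
    fix x :: "real ^ 'd" assume "x \<in> ?L"
    then have "\<bar>x $ k\<bar> \<le> 1" for k
      using component_le_lp_norm[OF \<open>1 \<le> p\<close>, of x k] by simp
    then show "x \<in> ?C 1"
      by (auto simp: mem_box_cart abs_le_iff minus_le_iff)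
  qed
  then have le: "measure lborel ?L \<le> 2 ^ CARD('d)"
    using measure_mono_fmeasurable[OF _ L C_sets, of 1] C[of 1] by simp
  have fin: "?L \<in> fmeasurable lborel"
    using C_sets[of 1] \<open>?L \<subseteq> ?C 1\<close> L by (rule fmeasurableI2)
  have "?C (1 / ?d) \<subseteq> ?L"
  proof
    fix x :: "real ^ 'd" assume "x \<in> ?C (1 / ?d)"
    then have "\<bar>x $ k\<bar> \<le> 1 / ?d" for k
      by (auto simp: mem_box_cart abs_le_iff minus_le_iff)
    then show "x \<in> ?L"
      using lp_norm_le_of_components[OF \<open>1 \<le> p\<close>, of x 1] by simp
  qed
  then have "(2 / ?d) ^ CARD('d) \<le> measure lborel ?L"
    using measure_mono_fmeasurable[OF _ _ fin, of "?C (1 / ?d)"] C[of "1 / ?d"] by simp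
  moreover have "0 < (2 / ?d) ^ CARD('d)"
    by simp
  ultimately have "0 < measure lborel ?L"
    by linarith
  moreover have "measure lborel (cball (0 :: real ^ 'd) 1) = \<omega>"
    by (simp add: content_cball \<omega>_def)
  moreover have "0 < \<omega>"
    by (simp add: \<omega>_def)
  ultimately show "0 < lp_ball_ratio TYPE('d) p" "lp_ball_ratio TYPE('d) p \<le> 2 ^ CARD('d) / \<omega>"
    using le by (simp_all add: lp_ball_ratio_def divide_right_mono)
qed

text \<open>Both alternatives of the regime bound \<open>r n ^ d\<close> from below by \<open>ln n / (\<alpha> n)\<close>, because \<open>2 (d - 1) / d \<ge> 1\<close> when \<open>d \<ge> 2\<close>; and
\<open>\<alpha> \<le> 2 ^ d / vol (B)\<close>, with \<open>B\<close> the Euclidean unit ball, makes the constant independent of \<open>p\<close>.\<close>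

lemma connectivity_regime_volume_ge:
  assumes "2 \<le> CARD('d::finite)" "1 \<le> p" and reg: "connectivity_regime TYPE('d) p r"
  shows "\<forall>\<^sub>F n in sequentially.
    ln (real n) / 2 ^ CARD('d) \<le> real n * (r n ^ CARD('d) / unit_ball_vol (real CARD('d)))"
proof -
  let ?d = "real CARD('d)"
  define \<alpha> where "\<alpha> = lp_ball_ratio TYPE('d) p"
  define \<omega> where "\<omega> = unit_ball_vol ?d"
  have \<alpha>: "0 < \<alpha>" "\<alpha> \<le> 2 ^ CARD('d) / \<omega>"
    using lp_ball_ratio_bounds[OF \<open>1 \<le> p\<close>, where 'd = 'd] by (auto simp: \<alpha>_def \<omega>_def)
  have \<omega>: "0 < \<omega>"
    by (simp add: \<omega>_def)
  have d: "2 \<le> ?d"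
    using assms(1) by simp
  then have ratio: "1 \<le> 2 * (?d - 1) / ?d"
    by (simp add: field_simps)
  have "\<forall>\<^sub>F n in sequentially. (ln (real n) / (\<alpha> * real n)) powr (1 / ?d) \<le> r n"
    using reg unfolding connectivity_regime_def Let_def \<alpha>_def[symmetric]
  proof (elim disjE conjE exE)
    fix \<gamma> :: "nat \<Rightarrow> real"
    assume \<gamma>: "\<forall>n. 0 \<le> \<gamma> n"
    assume "\<forall>\<^sub>F n in sequentially. (1 / (\<alpha> * real n) *
         (2 * (?d - 1) / ?d * ln (real n) + 2 / ?d * ln (ln (real n)) + \<gamma> n)) powr (1 / ?d) \<le> r n"
    moreover have "\<forall>\<^sub>F n in sequentially. 3 \<le> n"
      by (rule eventually_ge_at_top)
    ultimately show ?thesis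
    proof eventually_elim
      case (elim n)
      have "exp 1 \<le> real n"
        using exp_le \<open>3 \<le> n\<close> by (meson numeral_le_real_of_nat_iff order_trans)
      then have "1 \<le> ln (real n)"
        using \<open>3 \<le> n\<close> by (subst ln_ge_iff) auto
      then have "1 * ln (real n) \<le> 2 * (?d - 1) / ?d * ln (real n)"
        using ratio by (intro mult_right_mono) auto
      moreover have "0 \<le> 2 / ?d * ln (ln (real n))"
        using \<open>1 \<le> ln (real n)\<close> by simp
      ultimately have "ln (real n) \<le>
          2 * (?d - 1) / ?d * ln (real n) + 2 / ?d * ln (ln (real n)) + \<gamma> n"
        using \<gamma>[rule_format, of n] by linarith
      then have "1 / (\<alpha> * real n) * ln (real n) \<le> 1 / (\<alpha> * real n) *
          (2 * (?d - 1) / ?d * ln (real n) + 2 / ?d * ln (ln (real n)) + \<gamma> n)"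
        using \<alpha> by (intro mult_left_mono) auto
      then have "(ln (real n) / (\<alpha> * real n)) powr (1 / ?d) \<le> (1 / (\<alpha> * real n) *
          (2 * (?d - 1) / ?d * ln (real n) + 2 / ?d * ln (ln (real n)) + \<gamma> n)) powr (1 / ?d)"
        using \<alpha> \<open>1 \<le> ln (real n)\<close> by (intro powr_mono2) auto
      with elim show ?case
        by linarith
    qed
  next
    fix c
    assume c: "2 * (?d - 1) / (?d * \<alpha>) < c"
    assume "\<forall>\<^sub>F n in sequentially. r n = (c * ln (real n) / real n) powr (1 / ?d)"
    moreover have "\<forall>\<^sub>F n in sequentially. 1 \<le> n"
      by (rule eventually_ge_at_top)
    ultimately show ?thesis
    proof eventually_elim
      case (elim n)
      have "1 / \<alpha> \<le> 2 * (?d - 1) / ?d / \<alpha>"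
        using ratio \<alpha> by (intro divide_right_mono) auto
      with c have "1 / \<alpha> \<le> c"
        by simp
      then have "1 / \<alpha> * (ln (real n) / real n) \<le> c * (ln (real n) / real n)"
        using elim by (intro mult_right_mono) auto
      then have "(ln (real n) / (\<alpha> * real n)) powr (1 / ?d) \<le>
          (c * ln (real n) / real n) powr (1 / ?d)"
        using \<alpha> elim by (intro powr_mono2) auto
      with elim show ?case
        by simp
    qed
  qed
  moreover have "\<forall>\<^sub>F n in sequentially. 2 \<le> n"
    by (rule eventually_ge_at_top)
  ultimately show ?thesis
  proof eventually_elim
    case (elim n)
    have "0 < ln (real n)"
      using elim by simp
    then have "ln (real n) / (\<alpha> * real n) = ((ln (real n) / (\<alpha> * real n)) powr (1 / ?d)) ^ CARD('d)"
      using \<alpha> elim by (simp add: powr_powr flip: powr_realpow)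
    also have "\<dots> \<le> r n ^ CARD('d)"
      using elim by (intro power_mono) auto
    finally have *: "ln (real n) / \<alpha> \<le> real n * r n ^ CARD('d)"
      using \<alpha> elim by (simp add: field_simps)
    have "ln (real n) / (2 ^ CARD('d) / \<omega>) \<le> ln (real n) / \<alpha>"
      using \<alpha> \<omega> \<open>0 < ln (real n)\<close> by (intro divide_left_mono) auto
    with * have "ln (real n) / (2 ^ CARD('d) / \<omega>) \<le> real n * r n ^ CARD('d)"
      by linarith
    then show ?case
      using \<omega> by (simp add: field_simps \<omega>_def)
  qed
qed

section \<open>Distances in the random geometric graph\<close>

text \<open>Allowing a hop to stay in place makes it
unnecessary to know whether two chosen vertices coincide; it can only shorten a walk.\<close>

definition hop_relation :: "ereal \<Rightarrow> real \<Rightarrow> (real ^ 'd) set \<Rightarrow> ((real ^ 'd) \<times> (real ^ 'd)) set" where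
  "hop_relation p r V = {(x, y). x \<in> V \<and> y \<in> V \<and> (x = y \<or> lp_norm p (x - y) \<le> r)}"

lemma awalk_if_hop_relation_relpow:
  assumes "finite V" "(x, y) \<in> hop_relation p r V ^^ l" "x \<in> V"
  shows "\<exists>w. pre_digraph.awalk (with_proj (geometric_graph p r V)) x w y \<and> length w \<le> l"
  using assms(2,3)
proof (induction l arbitrary: x)
  case 0
  interpret pair_graph "geometric_graph p r V"
    by (rule pair_graph_geometric_graph) fact
  have "awalk x [] y"
    using 0 by (simp add: awalk_Nil_iff) (simp add: geometric_graph_def)
  then show ?case
    by auto
next
  case (Suc l)
  interpret pair_graph "geometric_graph p r V"
    by (rule pair_graph_geometric_graph) fact
  obtain z where z: "(x, z) \<in> hop_relation p r V" "(z, y) \<in> hop_relation p r V ^^ l"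
    using Suc.prems(1) by (elim relpow_Suc_E2)
  then have "z \<in> V"
    by (simp add: hop_relation_def)
  then obtain w where w: "awalk z w y" "length w \<le> l"
    using Suc.IH[OF z(2)] by blast
  show ?case
  proof (cases "x = z")
    case True
    with w show ?thesis
      by (meson le_SucI)
  next
    case False
    with z(1) have "(x, z) \<in> parcs (geometric_graph p r V)"
      by (auto simp: hop_relation_def geometric_graph_def)
    with w have "awalk x ((x, z) # w) y"
      by (simp add: awalk_Cons_iff)
    with w(2) show ?thesis
      by (intro exI[of _ "(x, z) # w"]) simp
  qed
qed

lemma hop_relation_relpow_if_awalk:
  assumes "finite V" "pre_digraph.awalk (with_proj (geometric_graph p r V)) x w y"
  shows "(x, y) \<in> hop_relation p r V ^^ length w"
  using assms(2)
proof (induction w arbitrary: x)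
  interpret pair_graph "geometric_graph p r V"
    by (rule pair_graph_geometric_graph) fact
  {
    case Nil
    then show ?case
      by (simp add: awalk_Nil_iff)
  next
    case (Cons e w)
    obtain z where e: "e = (x, z)" "(x, z) \<in> parcs (geometric_graph p r V)" "awalk z w y"
      using Cons.prems by (cases e) (auto simp: awalk_Cons_iff)
    then have "(x, z) \<in> hop_relation p r V"
      by (auto simp: hop_relation_def geometric_graph_def)
    with Cons.IH[OF e(3)] show ?case
      unfolding list.size(4) add_Suc_right add_0_right by (rule relpow_Suc_I2[rotated])
  }
qed

text \<open>The infimum defining the distance is over natural numbers, hence attained as soon as some walk
exists. The right-hand side is a countable union of conditions on the individual points, which
is what makes the distance event measurable.\<close>

lemma graph_dist_le_iff:
  assumes "finite V" "x \<in> V"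
  shows "graph_dist (geometric_graph p r V) x y \<le> ereal t \<longleftrightarrow>
    (\<exists>l. (x, y) \<in> hop_relation p r V ^^ l \<and> real l \<le> t)"
proof -
  interpret pair_graph "geometric_graph p r V"
    by (rule pair_graph_geometric_graph) fact
  let ?W = "{w. awalk x w y}"
  show ?thesis
  proof
    assume le: "graph_dist (geometric_graph p r V) x y \<le> ereal t"
    have "?W \<noteq> {}"
    proof
      assume "?W = {}"
      with le show False
        by (simp add: graph_dist_eq top_ereal_def)
    qed
    then obtain w where w: "awalk x w y" and min: "\<And>w'. awalk x w' y \<Longrightarrow> length w \<le> length w'"
      using ex_has_least_nat[of "\<lambda>w. awalk x w y" _ length] by blast
    have "ereal (length w) \<le> graph_dist (geometric_graph p r V) x y"
      unfolding graph_dist_eq using min by (intro INF_greatest) auto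
    with le have "real (length w) \<le> t"
      using order_trans ereal_less_eq(3) by blast
    with hop_relation_relpow_if_awalk[OF \<open>finite V\<close> w]
    show "\<exists>l. (x, y) \<in> hop_relation p r V ^^ l \<and> real l \<le> t"
      by blast
  next
    assume "\<exists>l. (x, y) \<in> hop_relation p r V ^^ l \<and> real l \<le> t"
    then obtain l w where w: "awalk x w y" "length w \<le> l" "real l \<le> t"
      using awalk_if_hop_relation_relpow[OF \<open>finite V\<close> _ \<open>x \<in> V\<close>] by blast
    then have "graph_dist (geometric_graph p r V) x y \<le> ereal (length w)"
      unfolding graph_dist_eq by (intro INF_lower) auto
    also have "\<dots> \<le> ereal t"
      using w by simp
    finally show "graph_dist (geometric_graph p r V) x y \<le> ereal t" .
  qed
qed

lemma measurable_random_points_component: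
  assumes "k \<in> {1..n}"
  shows "(\<lambda>v. v k) \<in> borel_measurable (random_points n :: (nat \<Rightarrow> real ^ 'd::finite) measure)"
proof -
  have "(\<lambda>v. v k) \<in> random_points n \<rightarrow>\<^sub>M uniform_measure lborel (cball (0 :: real ^ 'd) 1)"
    unfolding random_points_def using assms by (rule measurable_component_singleton)
  then show ?thesis
    by (simp cong: measurable_cong_sets)
qed

text \<open>Vertices are referred to by their indices here: the intermediate vertex of a composition then
ranges over a finite set that does not depend on the sample.\<close>

lemma pred_hop_relation_relpow:
  assumes "i \<in> {1..n}" "j \<in> {1..n}"
  shows "Measurable.pred (random_points n :: (nat \<Rightarrow> real ^ 'd::finite) measure)
    (\<lambda>v. (v i, v j) \<in> hop_relation p r (v ` {1..n}) ^^ l)"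
  using assms(2)
proof (induction l arbitrary: j)
  let ?M = "random_points n :: (nat \<Rightarrow> real ^ 'd) measure"
  have eq: "Measurable.pred ?M (\<lambda>v. v k = v j)" if "k \<in> {1..n}" "j \<in> {1..n}" for j k
    using measurable_equality_set[OF that[THEN measurable_random_points_component]]
    by (simp add: pred_def)
  {
    case 0
    show ?case
      using eq[OF assms(1) 0] by simp
  next
    case (Suc l)
    have "Measurable.pred ?M (\<lambda>v. lp_norm p (v k - v j) \<le> r)" if "k \<in> {1..n}" for k
    proof -
      note [measurable] = that[THEN measurable_random_points_component]
        Suc.prems[THEN measurable_random_points_component] borel_measurable_lp_norm
      show ?thesis
        by measurable
    qed
    then have "Measurable.pred ?M (\<lambda>v. \<exists>k\<in>{1..n}. (v i, v k) \<in> hop_relation p r (v ` {1..n}) ^^ l \<and>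
         (v k = v j \<or> lp_norm p (v k - v j) \<le> r))"
      using Suc.IH eq Suc.prems by (intro pred_intros_finite pred_intros_logic) auto
    also have "(\<lambda>v :: nat \<Rightarrow> real ^ 'd. \<exists>k\<in>{1..n}. (v i, v k) \<in> hop_relation p r (v ` {1..n}) ^^ l \<and>
         (v k = v j \<or> lp_norm p (v k - v j) \<le> r)) =
       (\<lambda>v. (v i, v j) \<in> hop_relation p r (v ` {1..n}) ^^ Suc l)"
      using Suc.prems by (intro ext) (auto simp: hop_relation_def relcomp_unfold)
    finally show ?case .
  }
qed

section \<open>Crossing a sequence of windows with few defects\<close>

lemma relpow_along_line:
  fixes g :: "nat \<Rightarrow> 'a"
  assumes step: "\<And>i i'. i < N \<Longrightarrow> i' < N \<Longrightarrow> \<bar>int i - int i'\<bar> \<le> 1 \<Longrightarrow> (g i, g i') \<in> R"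
    and "i < N" "i' < N"
  shows "(g i, g i') \<in> R ^^ N"
proof -
  have "(g i, g i') \<in> R ^^ L" if "\<bar>int i - int i'\<bar> \<le> int L" "i' < N" for L
    using that
  proof (induction L arbitrary: i')
    case (Suc L)
    define k where "k = (if i' < i then Suc i' else if i < i' then i' - 1 else i')"
    \<comment> \<open>\<open>k\<close> is one step closer to \<open>i\<close> than \<open>i'\<close> is, unless \<open>i' = i\<close>.\<close>
    have "\<bar>int i - int k\<bar> \<le> int L" "k < N" "\<bar>int k - int i'\<bar> \<le> 1"
      using Suc.prems \<open>i < N\<close> by (auto simp: k_def)
    then show ?case
      using Suc.IH step \<open>i' < N\<close> Suc.prems by auto
  qed simp
  then show ?thesis
    using assms by simp
qed

text \<open>Fewer than \<open>M\<close> points spoil fewer than \<open>M\<close> rows, so two windows with \<open>N \<ge> 2 M\<close> rows have an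
unspoilt row in common.\<close>

lemma exists_full_lines:
  fixes A B :: "(nat \<times> nat) set"
  assumes "finite A" "finite B" "card A < M" "card B < M" "2 * M \<le> N"
  shows "\<exists>i<N. i \<notin> fst ` A \<and> i \<notin> fst ` B" and "\<exists>j<N. j \<notin> snd ` A"
proof -
  have "card (fst ` A \<union> fst ` B) \<le> card A + card B"
    by (meson add_mono card_Un_le card_image_le assms(1,2) order_trans)
  then have "card (fst ` A \<union> fst ` B) < card {..<N}"
    using assms by simp
  then have "\<not> {..<N} \<subseteq> fst ` A \<union> fst ` B"
    using assms(1,2) by (meson card_mono finite_UnI finite_imageI not_le)
  then show "\<exists>i<N. i \<notin> fst ` A \<and> i \<notin> fst ` B"
    by blast
  have "card (snd ` A) < card {..<N}"
    using card_image_le[OF assms(1), of snd] assms by simp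
  then have "\<not> {..<N} \<subseteq> snd ` A"
    using assms(1) by (meson card_mono finite_imageI not_le)
  then show "\<exists>j<N. j \<notin> snd ` A"
    by blast
qed

text \<open>The combinatorial core. Consider \<open>m + 1\<close> square windows of side \<open>N\<close>, where \<open>E k\<close> is the set of
defective positions of window \<open>k\<close> and the same position in consecutive windows counts as
adjacent. If every window has fewer than \<open>M \<le> N / 2\<close> defects, then each has a defect-free column, and
consecutive windows have a defect-free row in common. A path alternates between the two: along a
good column to the common good row, along that row to a good column of the next window, and one
step into the next window, which costs at most \<open>2 N + 1\<close> steps per window. Nothing has to be
known about the shape of the set of defects. Without defects in the first and the last window the
path may start and end at their corners.\<close>

lemma relpow_through_windows:
  fixes f :: "nat \<Rightarrow> nat \<Rightarrow> nat \<Rightarrow> 'a" and E :: "nat \<Rightarrow> (nat \<times> nat) set"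
  assumes step: "\<And>k k' i i' j j'. \<lbrakk>k \<le> m; k' \<le> m; i < N; i' < N; j < N; j' < N;
      (i, j) \<notin> E k; (i', j') \<notin> E k';
      \<bar>int k - int k'\<bar> + \<bar>int i - int i'\<bar> + \<bar>int j - int j'\<bar> \<le> 1\<rbrakk>
      \<Longrightarrow> (f k i j, f k' i' j') \<in> R"
    and fin: "\<And>k. finite (E k)" and small: "\<And>k. k \<le> m \<Longrightarrow> card (E k) < M"
    and N: "2 * M \<le> N" "0 < N"
    and ends: "E 0 = {}" "E m = {}"
  shows "(f 0 0 0, f m 0 0) \<in> R ^^ ((2 * N + 1) * (m + 1))"
proof -
  have row: "(f k i j, f k i j') \<in> R ^^ N"
    if "k \<le> m" "i < N" "j < N" "j' < N" "i \<notin> fst ` E k" for k i j j'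
    using that by (intro relpow_along_line step) (auto simp: image_iff)
  have col: "(f k i j, f k i' j) \<in> R ^^ N"
    if "k \<le> m" "i < N" "i' < N" "j < N" "j \<notin> snd ` E k" for k i i' j
    using that by (intro relpow_along_line[where g = "\<lambda>i. f k i j"] step) (auto simp: image_iff)
  have "(f 0 0 0, f k i j) \<in> R ^^ ((2 * N + 1) * (k + 1))"
    if "k \<le> m" "j < N" "j \<notin> snd ` E k" "i < N" for k i j
    using that
  proof (induction k arbitrary: i j)
    case 0
    have 1: "(f 0 0 0, f 0 i 0) \<in> R ^^ N" and 2: "(f 0 i 0, f 0 i j) \<in> R ^^ N"
      using 0 ends by (auto intro!: row col)
    have 3: "(f 0 i j, f 0 i j) \<in> R ^^ 1"
      unfolding relpow_1 using 0 ends by (intro step) auto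
    have "(f 0 0 0, f 0 i j) \<in> R ^^ (N + N + 1)"
      using relpow_trans[OF relpow_trans[OF 1 2] 3] .
    then show ?case
      by (simp add: mult_2)
  next
    case (Suc k)
    obtain j\<^sub>0 where j\<^sub>0: "j\<^sub>0 < N" "j\<^sub>0 \<notin> snd ` E k"
      using exists_full_lines(2)[OF fin fin small small N(1), of k k] Suc.prems by auto
    obtain i\<^sub>0 where i\<^sub>0: "i\<^sub>0 < N" "i\<^sub>0 \<notin> fst ` E k" "i\<^sub>0 \<notin> fst ` E (Suc k)"
      using exists_full_lines(1)[OF fin fin small small N(1), of k "Suc k"] Suc.prems by auto
    have 1: "(f 0 0 0, f k i\<^sub>0 j\<^sub>0) \<in> R ^^ ((2 * N + 1) * (k + 1))"
      using Suc.IH[of j\<^sub>0 i\<^sub>0] Suc.prems j\<^sub>0 i\<^sub>0 by simp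
    have 2: "(f k i\<^sub>0 j\<^sub>0, f k i\<^sub>0 j) \<in> R ^^ N"
      using Suc.prems j\<^sub>0 i\<^sub>0 by (intro row) auto
    have 3: "(f k i\<^sub>0 j, f (Suc k) i\<^sub>0 j) \<in> R ^^ 1"
      unfolding relpow_1 using Suc.prems i\<^sub>0 by (intro step) (auto simp: image_iff)
    have 4: "(f (Suc k) i\<^sub>0 j, f (Suc k) i j) \<in> R ^^ N"
      using Suc.prems i\<^sub>0 by (intro col) auto
    have "(f 0 0 0, f (Suc k) i j) \<in> R ^^ ((2 * N + 1) * (k + 1) + N + 1 + N)"
      using relpow_trans[OF relpow_trans[OF relpow_trans[OF 1 2] 3] 4] .
    also have "(2 * N + 1) * (k + 1) + N + 1 + N = (2 * N + 1) * (Suc k + 1)"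
      by simp
    finally show ?case .
  qed
  from this[of m 0 0] show ?thesis
    using ends N by simp
qed

section \<open>Windows of cells along a segment\<close>

definition cell_index :: "real \<Rightarrow> real ^ 'd \<Rightarrow> int ^ 'd" where
  "cell_index s x = (\<chi> k. \<lfloor>x $ k / s\<rfloor>)"

text \<open>Windows extend in two coordinate directions only, whatever the dimension: a path uses the rows
and columns of a window, and the change of \<open>a\<close> from one window to the next takes care of all
other directions.\<close>

definition window_cell :: "'d \<Rightarrow> 'd \<Rightarrow> int ^ 'd \<Rightarrow> nat \<times> nat \<Rightarrow> int ^ 'd" where
  "window_cell k\<^sub>1 k\<^sub>2 a q = a + axis k\<^sub>1 (int (fst q)) + axis k\<^sub>2 (int (snd q))"

definition empty_cells ::
  "'d \<Rightarrow> 'd \<Rightarrow> nat \<Rightarrow> real \<Rightarrow> (real ^ 'd) set \<Rightarrow> int ^ 'd \<Rightarrow> (nat \<times> nat) set" where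
  "empty_cells k\<^sub>1 k\<^sub>2 N s V a =
     {q \<in> {..<N} \<times> {..<N}. \<forall>u\<in>V. cell_index s u \<noteq> window_cell k\<^sub>1 k\<^sub>2 a q}"

lemma cell_index_bounds:
  fixes x :: "real ^ 'd::finite"
  assumes "0 < s"
  shows "s * real_of_int (cell_index s x $ k) \<le> x $ k"
    and "x $ k < s * (real_of_int (cell_index s x $ k) + 1)"
  using floor_divide_lower[OF assms, of "x $ k"] floor_divide_upper[OF assms, of "x $ k"]
  by (simp_all add: cell_index_def mult.commute)

lemma cell_index_diff_le_1:
  fixes x y :: "real ^ 'd::finite"
  assumes "0 < s" "\<bar>x $ k - y $ k\<bar> \<le> s"
  shows "\<bar>cell_index s x $ k - cell_index s y $ k\<bar> \<le> 1"
proof -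
  have "\<bar>x $ k / s - y $ k / s\<bar> \<le> 1"
    using assms by (simp add: abs_le_iff field_simps)
  then show ?thesis
    unfolding cell_index_def vec_lambda_beta by linarith
qed

text \<open>This fixes the scale: with cells of side \<open>s = r / (2 d)\<close>, points of cells that share at least a
corner are adjacent in the graph with parameter \<open>r\<close>, for every \<open>p\<close>.\<close>

lemma lp_norm_le_if_neighbouring_cells:
  fixes u w :: "real ^ 'd::finite"
  assumes "0 < s" "1 \<le> p"
    and near: "\<And>k. \<bar>cell_index s u $ k - cell_index s w $ k\<bar> \<le> 1"
  shows "lp_norm p (u - w) \<le> 2 * real CARD('d) * s"
proof (rule lp_norm_le_of_components[OF \<open>1 \<le> p\<close>])
  fix k
  have "\<bar>real_of_int (cell_index s u $ k) - real_of_int (cell_index s w $ k)\<bar> \<le> 1"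
    using near[of k] by linarith
  then have "\<bar>s * real_of_int (cell_index s u $ k) - s * real_of_int (cell_index s w $ k)\<bar> \<le> s"
    using \<open>0 < s\<close> by (simp add: abs_mult flip: right_diff_distrib)
  with cell_index_bounds[OF \<open>0 < s\<close>, of u k] cell_index_bounds[OF \<open>0 < s\<close>, of w k]
  have "\<bar>u $ k - w $ k\<bar> \<le> 2 * s"
    by (simp add: algebra_simps abs_le_iff)
  then show "\<bar>(u - w) $ k\<bar> \<le> 2 * real CARD('d) * s / real CARD('d)"
    by simp
qed (use assms in auto)

lemma norm_le_if_in_window:
  fixes x z :: "real ^ 'd::finite"
  assumes "0 < s" "k\<^sub>1 \<noteq> k\<^sub>2" "q \<in> {..<N} \<times> {..<N}"
    and z: "cell_index s z = window_cell k\<^sub>1 k\<^sub>2 (cell_index s x) q"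
  shows "norm z \<le> norm x + real CARD('d) * s * real N"
proof -
  have "\<bar>z $ k - x $ k\<bar> \<le> s * real N" for k
  proof -
    define \<delta> where "\<delta> = cell_index s z $ k - cell_index s x $ k"
    have "0 \<le> \<delta>" "\<delta> + 1 \<le> int N"
      using assms(2,3) unfolding z \<delta>_def window_cell_def by (auto simp: axis_def)
    then have "0 \<le> s * real_of_int \<delta>" "s * (real_of_int \<delta> + 1) \<le> s * real N"
      using \<open>0 < s\<close> by auto
    moreover have "s * real_of_int (cell_index s z $ k) =
        s * real_of_int (cell_index s x $ k) + s * real_of_int \<delta>"
      by (simp add: \<delta>_def algebra_simps)
    ultimately show ?thesis
      using cell_index_bounds[OF \<open>0 < s\<close>, of z k] cell_index_bounds[OF \<open>0 < s\<close>, of x k]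
      by (simp add: algebra_simps abs_le_iff)
  qed
  then have "norm (z - x) \<le> (\<Sum>k\<in>(UNIV :: 'd set). s * real N)"
    by (intro order_trans[OF norm_le_l1_cart] sum_mono) auto
  also have "\<dots> = real CARD('d) * s * real N"
    by simp
  finally show ?thesis
    using norm_triangle_sub[of z x] by linarith
qed

text \<open>The windows at the cells met by equally spaced points of the segment from \<open>x\<close> to \<open>y\<close> form a
sequence as in \<open>relpow_through_windows\<close>: if consecutive sample points differ by at most \<open>s\<close> in
each coordinate, their cells are neighbours, and so are cells at the same relative position in
their windows. The number of windows is of order \<open>norm (x - y) / s\<close>; the lower bound on
\<open>norm (x - y)\<close> absorbs the additive constants.\<close>

lemma hop_path_along_segment:
  fixes x y :: "real ^ 'd::finite"
  assumes "0 < s" "1 \<le> p" "x \<in> V" "y \<in> V" "s \<le> norm (x - y)"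
    and N: "2 * M \<le> N" "0 < N"
    and small: "\<And>z. z \<in> closed_segment x y \<Longrightarrow> card (empty_cells k\<^sub>1 k\<^sub>2 N s V (cell_index s z)) < M"
    and full_x: "empty_cells k\<^sub>1 k\<^sub>2 N s V (cell_index s x) = {}"
    and full_y: "empty_cells k\<^sub>1 k\<^sub>2 N s V (cell_index s y) = {}"
  shows "\<exists>l. (x, y) \<in> hop_relation p (2 * real CARD('d) * s) V ^^ l \<and>
    real l \<le> (2 * real N + 3) * (3 * (norm (x - y) / s))"
proof -
  define m where "m = nat \<lceil>norm (x - y) / s\<rceil>"
  define z where "z k = x + (real k / real m) *\<^sub>R (y - x)" for k
  define a where "a k = cell_index s (z k)" for k
  define E where "E k = empty_cells k\<^sub>1 k\<^sub>2 N s V (a k)" for k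
  define f where "f k i j = (SOME u. u \<in> V \<and> cell_index s u = window_cell k\<^sub>1 k\<^sub>2 (a k) (i, j))" for k i j
  let ?R = "hop_relation p (2 * real CARD('d) * s) V"
  have m: "norm (x - y) / s \<le> real m" "real m \<le> 2 * (norm (x - y) / s)" "1 \<le> m"
  proof -
    have "1 \<le> norm (x - y) / s"
      using assms by simp
    then show "norm (x - y) / s \<le> real m" "real m \<le> 2 * (norm (x - y) / s)" "1 \<le> m"
      unfolding m_def by linarith+
  qed
  have f: "f k i j \<in> V \<and> cell_index s (f k i j) = window_cell k\<^sub>1 k\<^sub>2 (a k) (i, j)"
    if "i < N" "j < N" "(i, j) \<notin> E k" for k i j
    unfolding f_def by (rule someI_ex) (use that in \<open>auto simp: E_def empty_cells_def\<close>)
  have hop: "(u, w) \<in> ?R"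
    if "u \<in> V" "w \<in> V" "\<And>c. \<bar>cell_index s u $ c - cell_index s w $ c\<bar> \<le> 1" for u w
    using that lp_norm_le_if_neighbouring_cells[OF \<open>0 < s\<close> \<open>1 \<le> p\<close>, of u w]
    by (simp add: hop_relation_def)
  have a_step: "\<bar>a k $ c - a k' $ c\<bar> \<le> 1" if "\<bar>int k - int k'\<bar> \<le> 1" for k k' c
    unfolding a_def
  proof (rule cell_index_diff_le_1[OF \<open>0 < s\<close>])
    have "z k $ c - z k' $ c = (real k - real k') / real m * (y - x) $ c"
      by (simp add: z_def diff_divide_distrib algebra_simps)
    also have "\<bar>\<dots>\<bar> \<le> 1 / real m * norm (x - y)"
    proof -
      have "\<bar>real k - real k'\<bar> \<le> 1"
        using that by linarith
      moreover have "\<bar>(y - x) $ c\<bar> \<le> norm (x - y)"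
        using component_le_norm_cart[of "y - x" c] by (simp add: norm_minus_commute)
      ultimately show ?thesis
        unfolding abs_mult abs_divide abs_of_nat by (intro mult_mono divide_right_mono) auto
    qed
    also have "\<dots> \<le> s"
      using m(1,3) \<open>0 < s\<close> by (simp add: field_simps)
    finally show "\<bar>z k $ c - z k' $ c\<bar> \<le> s" .
  qed
  have z: "z 0 = x" "z m = y"
    using m(3) by (simp_all add: z_def)
  \<comment> \<open>A vertex \<open>f k i j\<close> is chosen in every occupied cell, not necessarily \<open>x\<close> in the
    cell of \<open>x\<close>; this accounts for one extra hop at either end.\<close>
  have middle: "(f 0 0 0, f m 0 0) \<in> ?R ^^ ((2 * N + 1) * (m + 1))"
  proof (rule relpow_through_windows[where E = E and M = M and f = f and N = N and m = m])
    fix k k' i i' j j'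
    assume *: "i < N" "i' < N" "j < N" "j' < N" "(i, j) \<notin> E k" "(i', j') \<notin> E k'"
      "\<bar>int k - int k'\<bar> + \<bar>int i - int i'\<bar> + \<bar>int j - int j'\<bar> \<le> 1"
    show "(f k i j, f k' i' j') \<in> ?R"
    proof (rule hop)
      fix c :: 'd
      let ?\<Delta> = "\<lambda>b i i'. if c = b then int i - int i' else 0"
      have "\<bar>a k $ c - a k' $ c\<bar> \<le> \<bar>int k - int k'\<bar>"
      proof (cases "k = k'")
        case False
        have "\<bar>int k - int k'\<bar> \<le> 1"
          using *(7) by linarith
        with False a_step[of k k' c] show ?thesis
          by linarith
      qed simp
      moreover have "\<bar>?\<Delta> k\<^sub>1 i i'\<bar> \<le> \<bar>int i - int i'\<bar>" "\<bar>?\<Delta> k\<^sub>2 j j'\<bar> \<le> \<bar>int j - int j'\<bar>"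
        by simp_all
      moreover have "cell_index s (f k i j) $ c - cell_index s (f k' i' j') $ c =
          (a k $ c - a k' $ c) + ?\<Delta> k\<^sub>1 i i' + ?\<Delta> k\<^sub>2 j j'"
        using f[OF *(1,3,5)] f[OF *(2,4,6)] by (simp add: window_cell_def axis_def)
      ultimately show "\<bar>cell_index s (f k i j) $ c - cell_index s (f k' i' j') $ c\<bar> \<le> 1"
        using *(7) by linarith
    qed (use f[OF *(1,3,5)] f[OF *(2,4,6)] in auto)
  next
    fix k
    show "finite (E k)"
      unfolding E_def empty_cells_def by simp
    assume "k \<le> m"
    then have "z k \<in> closed_segment x y"
      using m(3) unfolding z_def closed_segment_def
      by (intro CollectI exI[of _ "real k / real m"]) (auto simp: algebra_simps)
    then show "card (E k) < M"
      unfolding E_def a_def by (rule small)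
  qed (use N full_x full_y z in \<open>auto simp: E_def a_def\<close>)
  have first: "(x, f 0 0 0) \<in> ?R ^^ 1"
    unfolding relpow_1 using f[of 0 0 0] N full_x z assms(3)
    by (intro hop) (auto simp: E_def a_def window_cell_def axis_def)
  have last: "(f m 0 0, y) \<in> ?R ^^ 1"
    unfolding relpow_1 using f[of 0 0 m] N full_y z assms(4)
    by (intro hop) (auto simp: E_def a_def window_cell_def axis_def)
  have "(x, y) \<in> ?R ^^ (1 + (2 * N + 1) * (m + 1) + 1)"
    using relpow_trans[OF relpow_trans[OF first middle] last] .
  moreover have "real (1 + (2 * N + 1) * (m + 1) + 1) \<le> (2 * real N + 3) * (3 * (norm (x - y) / s))"
  proof -
    have "real (1 + (2 * N + 1) * (m + 1) + 1) \<le> (2 * real N + 3) * (real m + 1)"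
      by (simp add: algebra_simps)
    also have "\<dots> \<le> (2 * real N + 3) * (3 * (norm (x - y) / s))"
      using m assms by (intro mult_left_mono) (auto simp: field_simps)
    finally show ?thesis .
  qed
  ultimately show ?thesis
    by blast
qed

section \<open>Occupation of cells by uniform points\<close>

abbreviation uniform_ball :: "(real ^ 'd::finite) measure" where
  "uniform_ball \<equiv> uniform_measure lborel (cball 0 1)"

lemma emeasure_unit_cball:
  "emeasure lborel (cball (0 :: real ^ 'd::finite) 1) = ennreal (unit_ball_vol (real CARD('d)))"
  by (simp add: emeasure_cball)

lemma unit_ball_vol_neq_0 [simp]: "unit_ball_vol (real n) \<noteq> 0"
  using unit_ball_vol_pos[of "real n"] by (metis less_irrefl of_nat_0_le_iff)

lemma prob_space_uniform_ball: "prob_space (uniform_ball :: (real ^ 'd::finite) measure)"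
  by (intro prob_space_uniform_measure) (auto simp: emeasure_unit_cball)

lemma measure_uniform_ball:
  fixes A :: "(real ^ 'd::finite) set"
  assumes [measurable]: "A \<in> sets borel"
  shows "measure uniform_ball A =
    measure lborel (cball 0 1 \<inter> A) / unit_ball_vol (real CARD('d))"
proof -
  have "measure uniform_ball A = measure lborel (cball 0 1 \<inter> A) / measure lborel (cball (0 :: real ^ 'd) 1)"
    by (intro measure_uniform_measure) (auto simp: emeasure_unit_cball)
  then show ?thesis
    by (simp add: content_cball)
qed

lemma measure_uniform_ball_le:
  fixes A :: "(real ^ 'd::finite) set"
  assumes "A \<in> sets borel" "A \<subseteq> cbox l u" "\<And>k. l $ k \<le> u $ k"
  shows "measure uniform_ball A \<le> (\<Prod>k\<in>UNIV. u $ k - l $ k) / unit_ball_vol (real CARD('d))"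
proof -
  have "measure lborel (cball 0 1 \<inter> A) \<le> measure lborel (cbox l u)"
    using assms by (intro measure_mono_fmeasurable fmeasurable_cbox) auto
  also have "\<dots> = (\<Prod>k\<in>UNIV. u $ k - l $ k)"
    using assms by (intro content_cbox_cart) (simp add: interval_ne_empty_cart)
  finally show ?thesis
    unfolding measure_uniform_ball[OF assms(1)] by (intro divide_right_mono) auto
qed

definition cell :: "real \<Rightarrow> int ^ 'd \<Rightarrow> (real ^ 'd) set" where
  "cell s a = {x. cell_index s x = a}"

lemma mem_cell_iff:
  fixes x :: "real ^ 'd::finite"
  assumes "0 < s"
  shows "x \<in> cell s a \<longleftrightarrow>
    (\<forall>k. s * real_of_int (a $ k) \<le> x $ k \<and> x $ k < s * (real_of_int (a $ k) + 1))"
proof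
  assume "x \<in> cell s a"
  then show "\<forall>k. s * real_of_int (a $ k) \<le> x $ k \<and> x $ k < s * (real_of_int (a $ k) + 1)"
    using cell_index_bounds[OF assms, of x] by (auto simp: cell_def)
next
  assume *: "\<forall>k. s * real_of_int (a $ k) \<le> x $ k \<and> x $ k < s * (real_of_int (a $ k) + 1)"
  have "\<lfloor>x $ k / s\<rfloor> = a $ k" for k
    using *[rule_format, of k] assms by (simp add: floor_eq_iff field_simps)
  then show "x \<in> cell s a"
    by (simp add: cell_def cell_index_def vec_eq_iff)
qed

text \<open>With \<open>t = 0\<close> and \<open>t = 1\<close> these are the two extreme corners of the cell, with \<open>t = - 1\<close> and \<open>t = 2\<close>
those of the block consisting of the cell and its neighbours.\<close>

definition cell_corner :: "real \<Rightarrow> int ^ 'd \<Rightarrow> real \<Rightarrow> real ^ 'd" where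
  "cell_corner s a t = (\<chi> k. s * (real_of_int (a $ k) + t))"

lemma cell_subset_cbox:
  fixes a :: "int ^ 'd::finite"
  assumes "0 < s"
  shows "cell s a \<subseteq> cbox (cell_corner s a 0) (cell_corner s a 1)"
  by (auto simp: mem_cell_iff[OF assms] cell_corner_def mem_box_cart less_imp_le)

lemma borel_cell:
  fixes a :: "int ^ 'd::finite"
  assumes "0 < s"
  shows "cell s a \<in> sets borel"
proof -
  have "cell s a = (\<Inter>k. {x. s * real_of_int (a $ k) \<le> x $ k} \<inter> {x. x $ k < s * (real_of_int (a $ k) + 1)})"
    by (auto simp: mem_cell_iff[OF assms])
  also have "\<dots> \<in> sets borel"
    by (intro sets.finite_INT sets.Int)
      (auto intro!: borel_closed borel_open closed_halfspace_component_ge_cart open_halfspace_component_lt_cart)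
  finally show ?thesis .
qed

lemma disjoint_family_cell: "disjoint_family_on (cell s) A"
  by (auto simp: disjoint_family_on_def cell_def)

lemma prod_cell_corner:
  "(\<Prod>k\<in>(UNIV :: 'd::finite set). cell_corner s a u $ k - cell_corner s a t $ k) = (s * (u - t)) ^ CARD('d)"
  by (simp add: cell_corner_def flip: right_diff_distrib)

lemma measure_uniform_ball_cell_le:
  fixes a :: "int ^ 'd::finite"
  assumes "0 < s"
  shows "measure uniform_ball (cell s a) \<le> s ^ CARD('d) / unit_ball_vol (real CARD('d))"
proof -
  have "cell_corner s a 0 $ k \<le> cell_corner s a 1 $ k" for k
    using assms by (simp add: cell_corner_def)
  from measure_uniform_ball_le[OF borel_cell[OF assms] cell_subset_cbox[OF assms] this] show ?thesis
    by (simp add: prod_cell_corner)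
qed

lemma measure_uniform_ball_cell:
  fixes a :: "int ^ 'd::finite"
  assumes "0 < s" "cell s a \<subseteq> cball 0 1"
  shows "measure uniform_ball (cell s a) = s ^ CARD('d) / unit_ball_vol (real CARD('d))"
proof (rule antisym[OF measure_uniform_ball_cell_le[OF assms(1)]])
  let ?B = "box (cell_corner s a 0) (cell_corner s a 1)"
  have "measure lborel ?B = measure lborel (cbox (cell_corner s a 0) (cell_corner s a 1))"
    by (simp add: measure_lborel_box_eq measure_lborel_cbox_eq)
  also have "\<dots> = s ^ CARD('d)"
  proof (subst content_cbox_cart)
    show "cbox (cell_corner s a 0) (cell_corner s a 1) \<noteq> {}"
      using assms by (simp add: interval_ne_empty_cart cell_corner_def)
  qed (simp add: prod_cell_corner)
  finally have box: "measure lborel ?B = s ^ CARD('d)" .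
  have "?B \<subseteq> cell s a"
    by (auto simp: mem_cell_iff[OF assms(1)] cell_corner_def mem_box_cart less_imp_le)
  moreover have "cell s a \<in> fmeasurable lborel"
    using fmeasurable_cbox cell_subset_cbox[OF assms(1)] by (rule fmeasurableI2) (simp add: borel_cell assms)
  ultimately have "s ^ CARD('d) \<le> measure lborel (cell s a)"
    unfolding box[symmetric] by (intro measure_mono_fmeasurable) auto
  also have "cell s a = cball 0 1 \<inter> cell s a"
    using assms(2) by auto
  finally show "s ^ CARD('d) / unit_ball_vol (real CARD('d)) \<le> measure uniform_ball (cell s a)"
    unfolding measure_uniform_ball[OF borel_cell[OF assms(1)]] by (intro divide_right_mono) auto
qed

text \<open>A packing bound: the cells are disjoint and each carries the same mass, while the total mass is 1.\<close>

lemma card_cells_in_ball: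
  fixes A :: "(int ^ 'd::finite) set"
  assumes "0 < s" and A: "\<And>a. a \<in> A \<Longrightarrow> cell s a \<subseteq> cball 0 1"
  shows "finite A" and "real (card A) * (s ^ CARD('d) / unit_ball_vol (real CARD('d))) \<le> 1"
proof -
  interpret prob_space "uniform_ball :: (real ^ 'd) measure"
    by (rule prob_space_uniform_ball)
  let ?v = "s ^ CARD('d) / unit_ball_vol (real CARD('d))"
  have v: "0 < ?v"
    using assms by simp
  have *: "real (card F) * ?v \<le> 1" if "finite F" "F \<subseteq> A" for F
  proof -
    have "prob (\<Union>a\<in>F. cell s a) = (\<Sum>a\<in>F. prob (cell s a))"
      using that assms(1) by (intro finite_measure_finite_Union disjoint_family_cell) (auto simp: borel_cell)
    also have "\<dots> = (\<Sum>a\<in>F. ?v)"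
      using that A by (intro sum.cong measure_uniform_ball_cell assms(1)) auto
    finally show ?thesis
      using prob_le_1[of "\<Union>a\<in>F. cell s a"] by simp
  qed
  show "finite A"
  proof (rule ccontr)
    assume "infinite A"
    then obtain F where F: "finite F" "card F = Suc (nat \<lceil>1 / ?v\<rceil>)" "F \<subseteq> A"
      using infinite_arbitrarily_large by blast
    have "1 / ?v < real (card F)"
      unfolding F(2) by linarith
    then have "1 < real (card F) * ?v"
      using v by (simp only: pos_divide_less_eq)
    with *[OF F(1,3)] show False
      by linarith
  qed
  with * show "real (card A) * ?v \<le> 1"
    by simp
qed

lemma prob_space_random_points: "prob_space (random_points n :: (nat \<Rightarrow> real ^ 'd::finite) measure)"
  unfolding random_points_def by (intro prob_space_PiM prob_space_uniform_ball)

lemma random_points_all_in: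
  fixes X :: "nat \<Rightarrow> (real ^ 'd::finite) set"
  assumes "J \<subseteq> {1..n}" and X: "\<And>k. k \<in> J \<Longrightarrow> X k \<in> sets borel"
  shows "{v \<in> space (random_points n). \<forall>k\<in>J. v k \<in> X k} \<in> sets (random_points n)"
    and "measure (random_points n) {v \<in> space (random_points n). \<forall>k\<in>J. v k \<in> X k} =
      (\<Prod>k\<in>J. measure uniform_ball (X k))"
proof -
  interpret U: prob_space "uniform_ball :: (real ^ 'd) measure"
    by (rule prob_space_uniform_ball)
  interpret P: product_prob_space "\<lambda>_. uniform_ball :: (real ^ 'd) measure" "{1..n}" ..
  have J: "finite J"
    using assms(1) finite_subset by blast
  have "emeasure (random_points n) {v \<in> space (random_points n). \<forall>k\<in>J. v k \<in> X k} =
      (\<Prod>k\<in>J. emeasure uniform_ball (X k))"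
    unfolding random_points_def using assms J by (intro P.emeasure_PiM_Collect) auto
  also have "\<dots> = ennreal (\<Prod>k\<in>J. measure uniform_ball (X k))"
    by (simp add: U.emeasure_eq_measure prod_ennreal)
  finally show "measure (random_points n) {v \<in> space (random_points n). \<forall>k\<in>J. v k \<in> X k} =
      (\<Prod>k\<in>J. measure uniform_ball (X k))"
    by (simp add: measure_def prod_nonneg)
  show "{v \<in> space (random_points n). \<forall>k\<in>J. v k \<in> X k} \<in> sets (random_points n)"
  proof (intro sets.sets_Collect_finite_All J)
    fix k assume "k \<in> J"
    with assms show "{v \<in> space (random_points n). v k \<in> X k} \<in> sets (random_points n)"
      using measurable_sets[OF measurable_random_points_component[of k n], of "X k"]
      by (auto simp: vimage_def Int_def conj_commute)
  qed
qed

text \<open>A union bound that costs nothing. Conditions \<open>T a\<close> on the other points, depending on the cell \<open>a\<close>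
of point \<open>i\<close>, are independent of point \<open>i\<close> for each fixed \<open>a\<close>; and summing the masses of the
disjoint cells gives at most 1, whatever the number of cells. This replaces conditioning on the
position of point \<open>i\<close>.\<close>

lemma random_points_cell_and_others:
  fixes T :: "int ^ 'd::finite \<Rightarrow> nat \<Rightarrow> (real ^ 'd) set"
  assumes "0 < s" "finite A" "i \<in> {1..n}" "0 \<le> q"
    and T: "\<And>a k. a \<in> A \<Longrightarrow> T a k \<in> sets borel"
    and q: "\<And>a. a \<in> A \<Longrightarrow> (\<Prod>k\<in>{1..n} - {i}. measure uniform_ball (T a k)) \<le> q"
  defines "B \<equiv> {v \<in> space (random_points n). \<exists>a\<in>A. v i \<in> cell s a \<and> (\<forall>k\<in>{1..n} - {i}. v k \<in> T a k)}"
  shows "B \<in> sets (random_points n)" and "measure (random_points n) B \<le> q"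
proof -
  interpret U: prob_space "uniform_ball :: (real ^ 'd) measure"
    by (rule prob_space_uniform_ball)
  interpret prob_space "random_points n :: (nat \<Rightarrow> real ^ 'd) measure"
    by (rule prob_space_random_points)
  define X where "X a k = (if k = i then cell s a else T a k)" for a k
  define C where "C a = {v \<in> space (random_points n). \<forall>k\<in>{1..n}. v k \<in> X a k}" for a
  have X: "X a k \<in> sets borel" if "a \<in> A" for a k
    using that T borel_cell[OF assms(1), of a] by (simp add: X_def)
  have B: "B = (\<Union>a\<in>A. C a)"
  proof -
    have "{1..n} = insert i ({1..n} - {i})"
      using \<open>i \<in> {1..n}\<close> by auto
    then have "(\<forall>k\<in>{1..n}. v k \<in> X a k) \<longleftrightarrow> v i \<in> cell s a \<and> (\<forall>k\<in>{1..n} - {i}. v k \<in> T a k)" for a v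
      by (metis (no_types, lifting) X_def Diff_iff insert_iff singletonI)
    then show ?thesis
      unfolding B_def C_def by auto
  qed
  have C: "C a \<in> events" if "a \<in> A" for a
    unfolding C_def using X[OF that] by (intro random_points_all_in(1)) auto
  then show "B \<in> events"
    unfolding B using \<open>finite A\<close> by auto
  have "prob B \<le> (\<Sum>a\<in>A. prob (C a))"
    unfolding B using C \<open>finite A\<close> by (intro finite_measure_subadditive_finite) auto
  also have "\<dots> \<le> (\<Sum>a\<in>A. measure uniform_ball (cell s a) * q)"
  proof (intro sum_mono)
    fix a assume a: "a \<in> A"
    have "prob (C a) = (\<Prod>k\<in>{1..n}. measure uniform_ball (X a k))"
      unfolding C_def using X[OF a] by (intro random_points_all_in(2)) auto
    also have "\<dots> = measure uniform_ball (X a i) * (\<Prod>k\<in>{1..n} - {i}. measure uniform_ball (X a k))"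
      using \<open>i \<in> {1..n}\<close> by (intro prod.remove) auto
    also have "(\<Prod>k\<in>{1..n} - {i}. measure uniform_ball (X a k)) =
        (\<Prod>k\<in>{1..n} - {i}. measure uniform_ball (T a k))"
      by (intro prod.cong) (auto simp: X_def)
    also have "measure uniform_ball (X a i) * \<dots> \<le> measure uniform_ball (cell s a) * q"
      unfolding X_def using q[OF a] by (auto intro!: mult_left_mono)
    finally show "prob (C a) \<le> measure uniform_ball (cell s a) * q" .
  qed
  also have "\<dots> = measure uniform_ball (\<Union>a\<in>A. cell s a) * q"
    using \<open>finite A\<close> assms(1)
    by (subst U.finite_measure_finite_Union) (auto simp: borel_cell disjoint_family_cell sum_distrib_right)
  also have "\<dots> \<le> 1 * q"
    using \<open>0 \<le> q\<close> by (intro mult_right_mono U.prob_le_1)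
  finally show "prob B \<le> q"
    by simp
qed

section \<open>Unlikely configurations\<close>

text \<open>Only windows inside the unit ball are considered, since a cell that leaves the ball can be empty
with large probability.\<close>

definition window_grid :: "'d \<Rightarrow> 'd \<Rightarrow> nat \<Rightarrow> real \<Rightarrow> (int ^ 'd) set" where
  "window_grid k\<^sub>1 k\<^sub>2 N s =
     {a. \<forall>q \<in> {..<N} \<times> {..<N}. cell s (window_cell k\<^sub>1 k\<^sub>2 a q) \<subseteq> cball 0 1}"

lemma card_window_grid:
  fixes k\<^sub>1 k\<^sub>2 :: "'d::finite"
  assumes "0 < s" "0 < N"
  shows "finite (window_grid k\<^sub>1 k\<^sub>2 N s)"
    and "real (card (window_grid k\<^sub>1 k\<^sub>2 N s)) * (s ^ CARD('d) / unit_ball_vol (real CARD('d))) \<le> 1"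
proof -
  have "cell s a \<subseteq> cball 0 1" if "a \<in> window_grid k\<^sub>1 k\<^sub>2 N s" for a
  proof -
    have "window_cell k\<^sub>1 k\<^sub>2 a (0, 0) = a"
      by (simp add: window_cell_def axis_def vec_eq_iff)
    with that \<open>0 < N\<close> show ?thesis
      unfolding window_grid_def by force
  qed
  from card_cells_in_ball[OF \<open>0 < s\<close> this] show "finite (window_grid k\<^sub>1 k\<^sub>2 N s)"
    "real (card (window_grid k\<^sub>1 k\<^sub>2 N s)) * (s ^ CARD('d) / unit_ball_vol (real CARD('d))) \<le> 1"
    by blast+
qed

lemma cell_index_in_window_grid:
  fixes x :: "real ^ 'd::finite"
  assumes "0 < s" "k\<^sub>1 \<noteq> k\<^sub>2" "norm x \<le> 1 - real CARD('d) * s * real N"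
  shows "cell_index s x \<in> window_grid k\<^sub>1 k\<^sub>2 N s"
proof -
  have "norm z \<le> 1" if "q \<in> {..<N} \<times> {..<N}" "z \<in> cell s (window_cell k\<^sub>1 k\<^sub>2 (cell_index s x) q)" for q z
    using norm_le_if_in_window[OF assms(1,2) that(1), of z x] that(2) assms(3) by (simp add: cell_def)
  then show ?thesis
    by (auto simp: window_grid_def)
qed

lemma inj_window_cell:
  assumes "k\<^sub>1 \<noteq> k\<^sub>2"
  shows "inj (window_cell k\<^sub>1 k\<^sub>2 a)"
proof (rule injI)
  fix q q' assume eq: "window_cell k\<^sub>1 k\<^sub>2 a q = window_cell k\<^sub>1 k\<^sub>2 a q'"
  have "window_cell k\<^sub>1 k\<^sub>2 a q $ k\<^sub>1 = window_cell k\<^sub>1 k\<^sub>2 a q' $ k\<^sub>1"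
    "window_cell k\<^sub>1 k\<^sub>2 a q $ k\<^sub>2 = window_cell k\<^sub>1 k\<^sub>2 a q' $ k\<^sub>2"
    using eq by simp_all
  with assms show "q = q'"
    by (simp add: window_cell_def axis_def prod_eq_iff)
qed

text \<open>The probability that \<open>M\<close> given cells are all empty is at most \<open>exp (- n M w)\<close>, and the union bound
is over at most \<open>1 / w\<close> windows and \<open>2 ^ (N * N)\<close> sets of cells in each. When \<open>n w\<close> is of order
\<open>ln n\<close>, a constant \<open>M\<close> makes this small even if single empty cells abound.\<close>

lemma prob_window_with_many_empty_cells:
  fixes k\<^sub>1 k\<^sub>2 :: "'d::finite" and n M :: nat
  assumes "0 < s" "0 < N" "k\<^sub>1 \<noteq> k\<^sub>2"
  defines "w \<equiv> s ^ CARD('d) / unit_ball_vol (real CARD('d))"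
  defines "B \<equiv> {v \<in> space (random_points n). \<exists>a\<in>window_grid k\<^sub>1 k\<^sub>2 N s.
    M \<le> card (empty_cells k\<^sub>1 k\<^sub>2 N s (v ` {1..n}) a)}"
  shows "B \<in> sets (random_points n)"
    and "measure (random_points n) B \<le> 2 ^ (N * N) / w * exp (- (real n * real M * w))"
proof -
  interpret U: prob_space "uniform_ball :: (real ^ 'd) measure"
    by (rule prob_space_uniform_ball)
  interpret prob_space "random_points n :: (nat \<Rightarrow> real ^ 'd) measure"
    by (rule prob_space_random_points)
  let ?G = "window_grid k\<^sub>1 k\<^sub>2 N s"
  define Q where "Q = {..<N} \<times> {..<N}"
  define \<S> where "\<S> = {S. S \<subseteq> Q \<and> card S = M}"
  define X where "X a S = - (\<Union>q\<in>S. cell s (window_cell k\<^sub>1 k\<^sub>2 a q))" for a S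
  define C where "C a S = {v \<in> space (random_points n). \<forall>k\<in>{1..n}. v k \<in> X a S}" for a S
  note G = card_window_grid[OF assms(1,2), of k\<^sub>1 k\<^sub>2]
  have w: "0 < w"
    using \<open>0 < s\<close> by (simp add: w_def)
  have Q: "finite Q"
    by (simp add: Q_def)
  have "\<S> \<subseteq> Pow Q"
    by (auto simp: \<S>_def)
  then have \<S>: "finite \<S>" "card \<S> \<le> 2 ^ (N * N)"
    using card_mono[of "Pow Q" \<S>] Q by (auto simp: card_Pow finite_subset) (simp add: Q_def)
  have "M \<le> card (empty_cells k\<^sub>1 k\<^sub>2 N s (v ` {1..n}) a) \<longleftrightarrow>
      (\<exists>S\<in>\<S>. \<forall>k\<in>{1..n}. v k \<in> X a S)" for v a
  proof -
    let ?E = "empty_cells k\<^sub>1 k\<^sub>2 N s (v ` {1..n}) a"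
    have E: "?E \<subseteq> Q"
      by (auto simp: empty_cells_def Q_def)
    have in_E: "S \<subseteq> ?E \<longleftrightarrow> (\<forall>k\<in>{1..n}. v k \<in> X a S)" if "S \<subseteq> Q" for S
      using that by (auto simp: empty_cells_def Q_def X_def cell_def)
    show ?thesis
    proof
      assume "M \<le> card ?E"
      then obtain S where S: "S \<subseteq> ?E" "card S = M"
        using obtain_subset_with_card_n by metis
      then have "S \<in> \<S>"
        using E by (auto simp: \<S>_def)
      then show "\<exists>S\<in>\<S>. \<forall>k\<in>{1..n}. v k \<in> X a S"
        using in_E S by (auto simp: \<S>_def)
    next
      assume "\<exists>S\<in>\<S>. \<forall>k\<in>{1..n}. v k \<in> X a S"
      then obtain S where "S \<subseteq> ?E" "card S = M"
        using in_E by (auto simp: \<S>_def)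
      then show "M \<le> card ?E"
        using card_mono[of ?E S] E Q finite_subset by auto
    qed
  qed
  then have B: "B = (\<Union>(a, S)\<in>?G \<times> \<S>. C a S)"
    unfolding B_def C_def by auto
  have X: "X a S \<in> sets borel" if "S \<in> \<S>" for a S
  proof -
    have "finite S"
      using that Q finite_subset by (auto simp: \<S>_def)
    then have "(\<Union>q\<in>S. cell s (window_cell k\<^sub>1 k\<^sub>2 a q)) \<in> sets borel"
      by (intro sets.finite_UN borel_cell \<open>0 < s\<close>)
    then show ?thesis
      unfolding X_def by (rule borel_comp)
  qed
  have C: "C a S \<in> events" if "S \<in> \<S>" for a S
    unfolding C_def using X[OF that] by (intro random_points_all_in(1)) auto
  show "B \<in> events"
    unfolding B using C G(1) \<S>(1) by (intro sets.finite_UN) auto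
  have C_le: "prob (C a S) \<le> exp (- (real n * real M * w))" if "a \<in> ?G" "S \<in> \<S>" for a S
  proof -
    have S: "S \<subseteq> Q" "card S = M" "finite S"
      using that Q finite_subset by (auto simp: \<S>_def)
    have "U.prob (\<Union>q\<in>S. cell s (window_cell k\<^sub>1 k\<^sub>2 a q)) =
        (\<Sum>q\<in>S. U.prob (cell s (window_cell k\<^sub>1 k\<^sub>2 a q)))"
    proof (rule U.finite_measure_finite_Union)
      show "disjoint_family_on (\<lambda>q. cell s (window_cell k\<^sub>1 k\<^sub>2 a q)) S"
        using inj_window_cell[OF assms(3), of a]
        by (auto simp: disjoint_family_on_def cell_def inj_eq)
    qed (use S(3) borel_cell[OF assms(1)] in auto)
    also have "\<dots> = (\<Sum>q\<in>S. w)"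
      unfolding w_def using that(1) S(1)
      by (intro sum.cong refl measure_uniform_ball_cell assms(1)) (auto simp: window_grid_def Q_def)
    also have "\<dots> = real M * w"
      using S by simp
    finally have "U.prob (X a S) = 1 - real M * w"
      using U.prob_compl[of "\<Union>q\<in>S. cell s (window_cell k\<^sub>1 k\<^sub>2 a q)"] S(3) borel_cell[OF assms(1)]
      by (auto simp: X_def Compl_eq_Diff_UNIV)
    also have "\<dots> \<le> exp (- (real M * w))"
      using exp_ge_add_one_self[of "- (real M * w)"] by simp
    finally have "U.prob (X a S) ^ n \<le> exp (- (real M * w)) ^ n"
      by (intro power_mono) auto
    moreover have "prob (C a S) = U.prob (X a S) ^ n"
      unfolding C_def using random_points_all_in(2)[of "{1..n}" n "\<lambda>_. X a S"] X[OF that(2)] by simp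
    ultimately show ?thesis
      by (simp add: mult.assoc flip: exp_of_nat_mult)
  qed
  have "prob B \<le> (\<Sum>(a, S)\<in>?G \<times> \<S>. prob (C a S))"
    unfolding B case_prod_beta using C G(1) \<S>(1) by (intro finite_measure_subadditive_finite) auto
  also have "\<dots> \<le> (\<Sum>(a, S)\<in>?G \<times> \<S>. exp (- (real n * real M * w)))"
    using C_le by (intro sum_mono) auto
  also have "\<dots> = real (card ?G) * real (card \<S>) * exp (- (real n * real M * w))"
    by (simp add: card_cartesian_product)
  also have "\<dots> \<le> (1 / w) * 2 ^ (N * N) * exp (- (real n * real M * w))"
  proof (intro mult_mono)
    show "real (card ?G) \<le> 1 / w"
      using G(2) w by (simp add: w_def[symmetric] pos_le_divide_eq)
    show "real (card \<S>) \<le> 2 ^ (N * N)"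
      using \<S>(2) by (metis numeral_power_le_of_nat_cancel_iff of_nat_le_iff of_nat_numeral of_nat_power)
  qed (use w in auto)
  finally show "prob B \<le> 2 ^ (N * N) / w * exp (- (real n * real M * w))"
    by simp
qed

text \<open>A single sample point, in contrast to all of them at once, is likely to see no empty cell in its
window. The point itself is left out of the occupancy condition so that the condition is
independent of its position.\<close>

lemma prob_own_window_not_full:
  fixes k\<^sub>1 k\<^sub>2 :: "'d::finite"
  assumes "0 < s" "0 < N" "i \<in> {1..n}"
  defines "w \<equiv> s ^ CARD('d) / unit_ball_vol (real CARD('d))"
  defines "B \<equiv> {v \<in> space (random_points n). \<exists>a\<in>window_grid k\<^sub>1 k\<^sub>2 N s. v i \<in> cell s a \<and>
    (\<exists>q\<in>{..<N} \<times> {..<N}. \<forall>k\<in>{1..n} - {i}. v k \<in> - cell s (window_cell k\<^sub>1 k\<^sub>2 a q))}"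
  shows "B \<in> sets (random_points n)"
    and "measure (random_points n) B \<le> real (N * N) * exp (- (real (n - 1) * w))"
proof -
  interpret U: prob_space "uniform_ball :: (real ^ 'd) measure"
    by (rule prob_space_uniform_ball)
  interpret prob_space "random_points n :: (nat \<Rightarrow> real ^ 'd) measure"
    by (rule prob_space_random_points)
  let ?G = "window_grid k\<^sub>1 k\<^sub>2 N s"
  define C where "C q = {v \<in> space (random_points n). \<exists>a\<in>?G. v i \<in> cell s a \<and>
    (\<forall>k\<in>{1..n} - {i}. v k \<in> - cell s (window_cell k\<^sub>1 k\<^sub>2 a q))}" for q
  note G = card_window_grid[OF assms(1,2), of k\<^sub>1 k\<^sub>2]
  have B: "B = (\<Union>q\<in>{..<N} \<times> {..<N}. C q)"
    unfolding B_def C_def by auto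
  have T: "- cell s (window_cell k\<^sub>1 k\<^sub>2 a q) \<in> sets borel" for a q
    by (intro borel_comp borel_cell \<open>0 < s\<close>)
  have le: "(\<Prod>k\<in>{1..n} - {i}. U.prob (- cell s (window_cell k\<^sub>1 k\<^sub>2 a q))) \<le> exp (- (real (n - 1) * w))"
    if "a \<in> ?G" "q \<in> {..<N} \<times> {..<N}" for a q
  proof -
    have "U.prob (cell s (window_cell k\<^sub>1 k\<^sub>2 a q)) = w"
      unfolding w_def using that by (intro measure_uniform_ball_cell assms(1)) (auto simp: window_grid_def)
    then have "U.prob (- cell s (window_cell k\<^sub>1 k\<^sub>2 a q)) = 1 - w"
      using U.prob_compl[of "cell s (window_cell k\<^sub>1 k\<^sub>2 a q)"] borel_cell[OF assms(1)]
      by (auto simp: Compl_eq_Diff_UNIV)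
    also have "\<dots> \<le> exp (- w)"
      using exp_ge_add_one_self[of "- w"] by simp
    finally have "U.prob (- cell s (window_cell k\<^sub>1 k\<^sub>2 a q)) ^ (n - 1) \<le> exp (- w) ^ (n - 1)"
      by (intro power_mono) auto
    with \<open>i \<in> {1..n}\<close> show ?thesis
      by (simp flip: exp_of_nat_mult)
  qed
  note first_moment = random_points_cell_and_others[OF assms(1) G(1) assms(3) _ T le]
  have C: "C q \<in> events" "prob (C q) \<le> exp (- (real (n - 1) * w))" if "q \<in> {..<N} \<times> {..<N}" for q
    unfolding C_def using first_moment that by auto
  show "B \<in> events"
    unfolding B using C(1) by (intro sets.finite_UN) auto
  have "prob B \<le> (\<Sum>q\<in>{..<N} \<times> {..<N}. prob (C q))"
    unfolding B using C(1) by (intro finite_measure_subadditive_finite) auto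
  also have "\<dots> \<le> (\<Sum>q\<in>{..<N} \<times> {..<N}. exp (- (real (n - 1) * w)))"
    using C(2) by (intro sum_mono)
  finally show "prob B \<le> real (N * N) * exp (- (real (n - 1) * w))"
    by simp
qed

lemma prob_in_neighbouring_cells:
  fixes A :: "(int ^ 'd::finite) set"
  assumes "0 < s" "finite A" "i \<in> {1..n}" "j \<in> {1..n}" "i \<noteq> j"
  defines "w \<equiv> s ^ CARD('d) / unit_ball_vol (real CARD('d))"
  defines "B \<equiv> {v \<in> space (random_points n). \<exists>a\<in>A. v i \<in> cell s a \<and>
    v j \<in> cbox (cell_corner s a (- 1)) (cell_corner s a 2)}"
  shows "B \<in> sets (random_points n)" and "measure (random_points n) B \<le> 3 ^ CARD('d) * w"
proof -
  interpret U: prob_space "uniform_ball :: (real ^ 'd) measure"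
    by (rule prob_space_uniform_ball)
  define T :: "int ^ 'd \<Rightarrow> nat \<Rightarrow> (real ^ 'd) set"
    where "T a k = (if k = j then cbox (cell_corner s a (- 1)) (cell_corner s a 2) else UNIV)" for a k
  have B: "B = {v \<in> space (random_points n). \<exists>a\<in>A. v i \<in> cell s a \<and> (\<forall>k\<in>{1..n} - {i}. v k \<in> T a k)}"
    using assms(4,5) by (auto simp: B_def T_def)
  have T: "T a k \<in> sets borel" for a k
    by (simp add: T_def)
  have le: "(\<Prod>k\<in>{1..n} - {i}. U.prob (T a k)) \<le> 3 ^ CARD('d) * w" for a
  proof -
    have "(\<Prod>k\<in>{1..n} - {i}. U.prob (T a k)) =
        (\<Prod>k\<in>{1..n} - {i}. if k = j then U.prob (T a j) else 1)"
      using U.prob_space by (intro prod.cong) (auto simp: T_def)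
    also have "\<dots> = U.prob (T a j)"
      using assms(4,5) by (simp add: prod.delta)
    also have "\<dots> \<le> (\<Prod>k\<in>(UNIV :: 'd set). cell_corner s a 2 $ k - cell_corner s a (- 1) $ k) /
        unit_ball_vol (real CARD('d))"
      using T \<open>0 < s\<close> by (intro measure_uniform_ball_le) (auto simp: T_def cell_corner_def)
    also have "\<dots> = 3 ^ CARD('d) * w"
      unfolding prod_cell_corner w_def by (simp add: power_mult_distrib)
    finally show ?thesis .
  qed
  have "0 \<le> 3 ^ CARD('d) * w"
    using \<open>0 < s\<close> by (simp add: w_def)
  from random_points_cell_and_others[where T = T, OF assms(1-3) this T le]
  show "B \<in> sets (random_points n)" "measure (random_points n) B \<le> 3 ^ CARD('d) * w"
    unfolding B by auto
qed

lemma prob_near_boundary: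
  assumes "i \<in> {1..n}" "0 \<le> \<rho>" "\<rho> \<le> 1"
  defines "B \<equiv> {v \<in> space (random_points n :: (nat \<Rightarrow> real ^ 'd::finite) measure). v i \<in> - cball 0 (1 - \<rho>)}"
  shows "B \<in> sets (random_points n)" and "measure (random_points n) B = 1 - (1 - \<rho>) ^ CARD('d)"
proof -
  interpret U: prob_space "uniform_ball :: (real ^ 'd) measure"
    by (rule prob_space_uniform_ball)
  have X: "- cball (0 :: real ^ 'd) (1 - \<rho>) \<in> sets borel"
    by (intro borel_comp) simp
  have "cball 0 1 \<inter> cball 0 (1 - \<rho>) = (cball 0 (1 - \<rho>) :: (real ^ 'd) set)"
    using \<open>0 \<le> \<rho>\<close> by auto
  then have "U.prob (cball 0 (1 - \<rho>)) = (1 - \<rho>) ^ CARD('d)"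
    using \<open>\<rho> \<le> 1\<close> by (simp add: measure_uniform_ball content_cball)
  then have "U.prob (- cball 0 (1 - \<rho>)) = 1 - (1 - \<rho>) ^ CARD('d)"
    using U.prob_compl[of "cball 0 (1 - \<rho>)"] by (simp add: Compl_eq_Diff_UNIV)
  then show "B \<in> sets (random_points n)" "measure (random_points n) B = 1 - (1 - \<rho>) ^ CARD('d)"
    using random_points_all_in[of "{i}" n "\<lambda>_. - cball (0 :: real ^ 'd) (1 - \<rho>)"] X assms(1)
    by (simp_all add: B_def)
qed

section \<open>The distance bound\<close>

lemma in_cbox_around_cell:
  fixes x y :: "real ^ 'd::finite"
  assumes "0 < s" "norm (x - y) \<le> s"
  shows "y \<in> cbox (cell_corner s (cell_index s x) (- 1)) (cell_corner s (cell_index s x) 2)"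
proof -
  have "\<bar>x $ k - y $ k\<bar> \<le> s" for k
    using component_le_norm_cart[of "x - y" k] assms(2) by simp
  then show ?thesis
    using cell_index_bounds[OF \<open>0 < s\<close>, of x]
    by (auto simp: mem_box_cart cell_corner_def abs_le_iff algebra_simps)
      (smt (verit))+
qed

lemma graph_dist_event:
  assumes "i \<in> {1..n}" "j \<in> {1..n}"
  shows "{v \<in> space (random_points n :: (nat \<Rightarrow> real ^ 'd::finite) measure).
    graph_dist (geometric_graph p r (v ` {1..n})) (v i) (v j) \<le> ereal (K * norm (v i - v j) / r)}
    \<in> sets (random_points n)"
proof -
  let ?M = "random_points n :: (nat \<Rightarrow> real ^ 'd) measure"
  have "Measurable.pred ?M (\<lambda>v. (v i, v j) \<in> hop_relation p r (v ` {1..n}) ^^ l \<and>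
      real l \<le> K * norm (v i - v j) / r)" for l
  proof (rule pred_intros_logic(3))
    show "Measurable.pred ?M (\<lambda>v. (v i, v j) \<in> hop_relation p r (v ` {1..n}) ^^ l)"
      by (rule pred_hop_relation_relpow[OF assms])
    note [measurable] = assms[THEN measurable_random_points_component]
    show "Measurable.pred ?M (\<lambda>v. real l \<le> K * norm (v i - v j) / r)"
      by measurable
  qed
  then have "Measurable.pred ?M (\<lambda>v. \<exists>l. (v i, v j) \<in> hop_relation p r (v ` {1..n}) ^^ l \<and>
      real l \<le> K * norm (v i - v j) / r)"
    by (rule pred_intros_countable)
  also have "(\<lambda>v :: nat \<Rightarrow> real ^ 'd. \<exists>l. (v i, v j) \<in> hop_relation p r (v ` {1..n}) ^^ l \<and>
      real l \<le> K * norm (v i - v j) / r) =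
    (\<lambda>v. graph_dist (geometric_graph p r (v ` {1..n})) (v i) (v j) \<le> ereal (K * norm (v i - v j) / r))"
    using assms by (intro ext, subst graph_dist_le_iff) auto
  finally show ?thesis
    by (simp add: pred_def)
qed

text \<open>The bound holds unless one of six bad events occurs: one of the two points is close to the
boundary of the ball (probability \<open>1 - (1 - \<rho>) ^ d\<close> each), one of their windows is not full, the two
points are closer than \<open>s\<close>, or some window inside the ball has at least \<open>M\<close> empty cells. Otherwise
the whole segment between the points stays at distance at least \<open>\<rho>\<close> from the boundary by
convexity, so all windows along it lie inside the ball, and the path along the segment exists.\<close>

lemma prob_graph_dist_ge:
  fixes s :: real and N M n :: nat
  defines "\<rho> \<equiv> real CARD('d::finite) * s * real N"
    and "w \<equiv> s ^ CARD('d) / unit_ball_vol (real CARD('d))"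
    and "r \<equiv> 2 * real CARD('d) * s"
  assumes "2 \<le> CARD('d)" "1 \<le> p" "i \<in> {1..n}" "j \<in> {1..n}" "i \<noteq> j" "0 < s" "\<rho> \<le> 1"
    and N: "2 * M \<le> N" "0 < N"
  shows "1 - (2 * (1 - (1 - \<rho>) ^ CARD('d)) + 2 * (real (N * N) * exp (- (real (n - 1) * w))) +
      3 ^ CARD('d) * w + 2 ^ (N * N) / w * exp (- (real n * real M * w)))
    \<le> measure (random_points n :: (nat \<Rightarrow> real ^ 'd) measure) {v \<in> space (random_points n).
      graph_dist (geometric_graph p r (v ` {1..n})) (v i) (v j)
        \<le> ereal (6 * real CARD('d) * (2 * real N + 3) * norm (v i - v j) / r)}"
proof -
  interpret prob_space "random_points n :: (nat \<Rightarrow> real ^ 'd) measure"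
    by (rule prob_space_random_points)
  obtain k\<^sub>1 k\<^sub>2 :: 'd where "k\<^sub>1 \<noteq> k\<^sub>2"
    using \<open>2 \<le> CARD('d)\<close> by (metis UNIV_I card_2_iff' card_le_Suc0_iff_eq finite_code not_less_eq_eq numeral_2_eq_2)
  let ?G = "window_grid k\<^sub>1 k\<^sub>2 N s"
  let ?\<Omega> = "space (random_points n :: (nat \<Rightarrow> real ^ 'd) measure)"
  let ?K = "6 * real CARD('d) * (2 * real N + 3)"
  note G = card_window_grid(1)[OF \<open>0 < s\<close> \<open>0 < N\<close>, of k\<^sub>1 k\<^sub>2]
  define near_boundary where "near_boundary k = {v \<in> ?\<Omega>. v k \<in> - cball 0 (1 - \<rho>)}" for k
  define not_full where "not_full k = {v \<in> ?\<Omega>. \<exists>a\<in>?G. v k \<in> cell s a \<and>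
    (\<exists>q\<in>{..<N} \<times> {..<N}. \<forall>l\<in>{1..n} - {k}. v l \<in> - cell s (window_cell k\<^sub>1 k\<^sub>2 a q))}" for k
  define close where "close = {v \<in> ?\<Omega>. \<exists>a\<in>?G. v i \<in> cell s a \<and>
    v j \<in> cbox (cell_corner s a (- 1)) (cell_corner s a 2)}"
  define sparse where "sparse = {v \<in> ?\<Omega>. \<exists>a\<in>?G. M \<le> card (empty_cells k\<^sub>1 k\<^sub>2 N s (v ` {1..n}) a)}"
  define good where "good = {v \<in> ?\<Omega>. graph_dist (geometric_graph p r (v ` {1..n})) (v i) (v j)
        \<le> ereal (?K * norm (v i - v j) / r)}"
  have "0 \<le> \<rho>"
    using \<open>0 < s\<close> by (simp add: \<rho>_def)
  have B: "near_boundary k \<in> events" "prob (near_boundary k) = 1 - (1 - \<rho>) ^ CARD('d)" if "k \<in> {1..n}" for k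
    unfolding near_boundary_def using prob_near_boundary[OF that \<open>0 \<le> \<rho>\<close> \<open>\<rho> \<le> 1\<close>, where 'd = 'd] by auto
  have F: "not_full k \<in> events" "prob (not_full k) \<le> real (N * N) * exp (- (real (n - 1) * w))"
    if "k \<in> {1..n}" for k
    unfolding not_full_def w_def using prob_own_window_not_full[OF \<open>0 < s\<close> \<open>0 < N\<close> that] by auto
  have C: "close \<in> events" "prob close \<le> 3 ^ CARD('d) * w"
    unfolding close_def w_def using prob_in_neighbouring_cells[OF \<open>0 < s\<close> G assms(6-8)] by auto
  have S: "sparse \<in> events" "prob sparse \<le> 2 ^ (N * N) / w * exp (- (real n * real M * w))"
    unfolding sparse_def w_def
    using prob_window_with_many_empty_cells[OF \<open>0 < s\<close> \<open>0 < N\<close> \<open>k\<^sub>1 \<noteq> k\<^sub>2\<close>] by auto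
  have good: "good \<in> events"
    unfolding good_def using assms by (intro graph_dist_event) auto
  have cover: "?\<Omega> - good \<subseteq> near_boundary i \<union> near_boundary j \<union> not_full i \<union> not_full j \<union> close \<union> sparse"
  proof
    fix v assume v: "v \<in> ?\<Omega> - good"
    show "v \<in> near_boundary i \<union> near_boundary j \<union> not_full i \<union> not_full j \<union> close \<union> sparse"
    proof (rule ccontr)
      assume contr: "v \<notin> near_boundary i \<union> near_boundary j \<union> not_full i \<union> not_full j \<union> close \<union> sparse"
      let ?V = "v ` {1..n}"
      have norm: "norm (v k) \<le> 1 - \<rho>" if "k \<in> {i, j}" for k
        using that v contr by (auto simp: near_boundary_def)
      have inner: "cell_index s z \<in> ?G" if "norm z \<le> 1 - \<rho>" for z
        using that unfolding \<rho>_def by (rule cell_index_in_window_grid[OF \<open>0 < s\<close> \<open>k\<^sub>1 \<noteq> k\<^sub>2\<close>])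
      have full: "empty_cells k\<^sub>1 k\<^sub>2 N s ?V (cell_index s (v k)) = {}" if "k \<in> {i, j}" for k
      proof (rule ccontr)
        assume "empty_cells k\<^sub>1 k\<^sub>2 N s ?V (cell_index s (v k)) \<noteq> {}"
        then obtain q where "q \<in> {..<N} \<times> {..<N}"
          "\<forall>l\<in>{1..n}. v l \<in> - cell s (window_cell k\<^sub>1 k\<^sub>2 (cell_index s (v k)) q)"
          by (auto simp: empty_cells_def cell_def)
        then have "v \<in> not_full k"
          unfolding not_full_def using v inner[OF norm[OF that]] by (auto simp: cell_def)
        with that contr show False
          by auto
      qed
      have "s \<le> norm (v i - v j)"
      proof (rule ccontr)
        assume "\<not> s \<le> norm (v i - v j)"
        then have "v j \<in> cbox (cell_corner s (cell_index s (v i)) (- 1)) (cell_corner s (cell_index s (v i)) 2)"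
          by (intro in_cbox_around_cell \<open>0 < s\<close>) auto
        then have "v \<in> close"
          unfolding close_def using v inner[OF norm, of i] by (auto simp: cell_def)
        with contr show False
          by auto
      qed
      moreover have "card (empty_cells k\<^sub>1 k\<^sub>2 N s ?V (cell_index s z)) < M"
        if "z \<in> closed_segment (v i) (v j)" for z
      proof -
        have "closed_segment (v i) (v j) \<subseteq> cball 0 (1 - \<rho>)"
          using norm by (intro closed_segment_subset) auto
        with that have "cell_index s z \<in> ?G"
          by (intro inner) auto
        with v contr show ?thesis
          by (auto simp: sparse_def not_le)
      qed
      ultimately obtain l where l: "(v i, v j) \<in> hop_relation p r ?V ^^ l"
        "real l \<le> (2 * real N + 3) * (3 * (norm (v i - v j) / s))"
        using hop_path_along_segment[OF \<open>0 < s\<close> \<open>1 \<le> p\<close>, of "v i" ?V "v j" M N k\<^sub>1 k\<^sub>2]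
          assms(6,7) N full unfolding r_def by blast
      have "(2 * real N + 3) * (3 * (norm (v i - v j) / s)) = ?K * norm (v i - v j) / r"
        using \<open>0 < s\<close> by (simp add: r_def field_simps)
      with l have "graph_dist (geometric_graph p r ?V) (v i) (v j) \<le> ereal (?K * norm (v i - v j) / r)"
        using assms(6) by (subst graph_dist_le_iff) auto
      with v show False
        by (simp add: good_def)
    qed
  qed
  have ij: "i \<in> {1..n}" "j \<in> {1..n}"
    by fact+
  have "prob (?\<Omega> - good) \<le>
      prob (near_boundary i \<union> near_boundary j \<union> not_full i \<union> not_full j \<union> close \<union> sparse)"
    using cover B(1) F(1) C(1) S(1) ij by (intro finite_measure_mono) auto
  also have "\<dots> \<le> prob (near_boundary i) + prob (near_boundary j) + prob (not_full i) + prob (not_full j) +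
      prob close + prob sparse"
    using B(1) F(1) C(1) S(1) ij
    by (intro order_trans[OF measure_Un_le] add_right_mono sets.Un) auto
  also have "\<dots> \<le> 2 * (1 - (1 - \<rho>) ^ CARD('d)) + 2 * (real (N * N) * exp (- (real (n - 1) * w))) +
      3 ^ CARD('d) * w + 2 ^ (N * N) / w * exp (- (real n * real M * w))"
  proof -
    have "prob (near_boundary i) + prob (near_boundary j) = 2 * (1 - (1 - \<rho>) ^ CARD('d))"
      unfolding B(2)[OF ij(1)] B(2)[OF ij(2)] by simp
    moreover have "prob (not_full i) + prob (not_full j) \<le>
        2 * (real (N * N) * exp (- (real (n - 1) * w)))"
      unfolding mult_2 by (intro add_mono F(2) ij)
    ultimately show ?thesis
      using C(2) S(2) by (smt (verit, ccfv_threshold))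
  qed
  finally show ?thesis
    using prob_compl[OF good] unfolding good_def by linarith
qed

theorem theorem8:
  assumes "CARD('d::finite) \<ge> 2"
  shows "\<exists>K>0. \<forall>p\<ge>1. \<forall>r :: nat \<Rightarrow> real. \<forall>i j :: nat \<Rightarrow> nat.
    (\<forall>n\<ge>1. r n > 0) \<longrightarrow>
    connectivity_regime TYPE('d) p r \<longrightarrow>
    r \<longlonglongrightarrow> 0 \<longrightarrow>
    (\<forall>\<^sub>F n in sequentially. i n \<in> {1..n} \<and> j n \<in> {1..n} \<and> i n \<noteq> j n) \<longrightarrow>
    (\<lambda>n. \<P>(v in (random_points n :: (nat \<Rightarrow> real ^ 'd) measure).
            graph_dist (geometric_graph p (r n) (v ` {1..n})) (v (i n)) (v (j n))
              \<le> ereal (K * norm (v (i n) - v (j n)) / r n)))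
      \<longlonglongrightarrow> 1"
proof -
  define d where "d = CARD('d)"
  \<comment> \<open>With \<open>s = r / (2 d)\<close> a cell has mass at least \<open>ln n / (n (4 d) ^ d)\<close>. This value of \<open>M\<close> therefore
    makes \<open>exp (- n M w)\<close> at most \<open>1 / n\<close>, which beats the number \<open>1 / w\<close> of windows by a
    logarithmic factor.\<close>
  define M where "M = (4 * d) ^ d"
  define N where "N = 2 * M"
  define K where "K = 6 * real d * (2 * real N + 3)"
  define \<omega> where "\<omega> = unit_ball_vol (real d)"
  have d: "2 \<le> d"
    using assms by (simp add: d_def)
  then have M: "0 < M"
    by (simp add: M_def)
  have M_power: "real M = (2 * (2 * real d)) ^ d"
    by (simp add: M_def)
  have \<omega>: "0 < \<omega>"
    by (simp add: \<omega>_def)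
  have "0 < K"
    using d by (simp add: K_def)
  moreover have "(\<lambda>n. \<P>(v in (random_points n :: (nat \<Rightarrow> real ^ 'd) measure).
            graph_dist (geometric_graph p (r n) (v ` {1..n})) (v (i n)) (v (j n))
              \<le> ereal (K * norm (v (i n) - v (j n)) / r n))) \<longlonglongrightarrow> 1"
    if "1 \<le> p" and pos: "\<forall>n\<ge>1. r n > 0" and reg: "connectivity_regime TYPE('d) p r"
      and lim: "r \<longlonglongrightarrow> 0"
      and ij: "\<forall>\<^sub>F n in sequentially. i n \<in> {1..n} \<and> j n \<in> {1..n} \<and> i n \<noteq> j n"
    for p and r :: "nat \<Rightarrow> real" and i j :: "nat \<Rightarrow> nat"
  proof -
    define s where "s n = r n / (2 * real d)" for n
    define w where "w n = s n ^ d / \<omega>" for n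
    define \<rho> where "\<rho> n = real d * s n * real N" for n
    have s_lim: "s \<longlonglongrightarrow> 0"
      unfolding s_def using tendsto_divide[OF lim tendsto_const, of "2 * real d"] d by simp
    have w_lim: "w \<longlonglongrightarrow> 0"
      unfolding w_def using tendsto_divide[OF tendsto_power[OF s_lim, of d] tendsto_const, of \<omega>] s_lim \<omega> d by simp
    have \<rho>_lim: "\<rho> \<longlonglongrightarrow> 0"
      unfolding \<rho>_def by (rule tendsto_eq_intros s_lim | simp)+
    have w_ge: "\<forall>\<^sub>F n in sequentially. ln (real n) / real M \<le> real n * w n"
      using connectivity_regime_volume_ge[OF assms \<open>1 \<le> p\<close> reg]
    proof (elim eventually_mono)
      fix n
      assume "ln (real n) / 2 ^ CARD('d) \<le> real n * (r n ^ CARD('d) / unit_ball_vol (real CARD('d)))"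
      then have "ln (real n) / 2 ^ d / (2 * real d) ^ d \<le> real n * (r n ^ d / \<omega>) / (2 * real d) ^ d"
        unfolding d_def[symmetric] \<omega>_def by (intro divide_right_mono) auto
      moreover have "ln (real n) / 2 ^ d / (2 * real d) ^ d = ln (real n) / real M"
        unfolding M_power power_mult_distrib[of 2 "2 * real d"] by (rule divide_divide_eq_left)
      moreover have "real n * (r n ^ d / \<omega>) / (2 * real d) ^ d = real n * w n"
        by (simp add: w_def s_def power_divide)
      ultimately show "ln (real n) / real M \<le> real n * w n"
        by (simp only:)
    qed
    define bound where "bound n = 2 * (1 - (1 - \<rho> n) ^ d) +
      2 * (real (N * N) * (exp 1 * exp (- (ln (real n) / real M)))) + 3 ^ d * w n +
      2 ^ (N * N) * (real M / ln (real n))" for n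
    have exp_lim: "(\<lambda>n. exp (- (ln (real n) / real M))) \<longlonglongrightarrow> 0"
      using M by real_asymp
    have ln_lim: "(\<lambda>n. real M / ln (real n)) \<longlonglongrightarrow> 0"
      by real_asymp
    have "(\<lambda>n. 1 - bound n) \<longlonglongrightarrow> 1 - (2 * (1 - (1 - 0) ^ d) +
        2 * (real (N * N) * (exp 1 * 0)) + 3 ^ d * 0 + 2 ^ (N * N) * 0)"
      unfolding bound_def by (rule w_lim \<rho>_lim exp_lim ln_lim | rule tendsto_intros)+
    then have bound_lim: "(\<lambda>n. 1 - bound n) \<longlonglongrightarrow> 1"
      by simp
    have "\<forall>\<^sub>F n in sequentially. w n < 1" "\<forall>\<^sub>F n in sequentially. \<rho> n < 1"
      using w_lim \<rho>_lim by (auto intro: order_tendstoD)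
    moreover have "\<forall>\<^sub>F n in sequentially. 2 \<le> n"
      by (rule eventually_ge_at_top)
    ultimately have lower: "\<forall>\<^sub>F n in sequentially. 1 - bound n \<le>
        \<P>(v in (random_points n :: (nat \<Rightarrow> real ^ 'd) measure).
            graph_dist (geometric_graph p (r n) (v ` {1..n})) (v (i n)) (v (j n))
              \<le> ereal (K * norm (v (i n) - v (j n)) / r n))"
      using w_ge ij
    proof eventually_elim
      case (elim n)
      have "0 < r n"
        using pos elim by simp
      then have "0 < s n"
        using d by (simp add: s_def)
      then have "0 < w n"
        using \<omega> by (simp add: w_def)
      have "0 < ln (real n)"
        using elim by simp
      have r: "2 * real CARD('d) * s n = r n"
        using d by (simp add: s_def d_def)
      have "real (n - 1) * w n = real n * w n - w n"
        using elim by (simp add: of_nat_diff algebra_simps)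
      then have "- (real (n - 1) * w n) \<le> 1 + - (ln (real n) / real M)"
        using elim by linarith
      then have end_windows: "exp (- (real (n - 1) * w n)) \<le> exp 1 * exp (- (ln (real n) / real M))"
        unfolding exp_add[symmetric] by simp
      have "ln (real n) \<le> real n * real M * w n"
        using elim M by (simp add: field_simps)
      then have "exp (- (real n * real M * w n)) \<le> exp (- ln (real n))"
        by simp
      also have "\<dots> = 1 / real n"
        using elim by (simp add: exp_minus field_simps)
      finally have "1 / w n * exp (- (real n * real M * w n)) \<le> 1 / w n * (1 / real n)"
        using \<open>0 < w n\<close> by (intro mult_left_mono) auto
      also have "\<dots> = 1 / (real n * w n)"
        by simp
      also have "\<dots> \<le> 1 / (ln (real n) / real M)"
        using elim M \<open>0 < w n\<close> \<open>0 < ln (real n)\<close> by (intro divide_left_mono) auto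
      finally have "1 / w n * exp (- (real n * real M * w n)) \<le> real M / ln (real n)"
        by simp
      then have "2 ^ (N * N) * (1 / w n * exp (- (real n * real M * w n))) \<le>
          2 ^ (N * N) * (real M / ln (real n))"
        by (rule mult_left_mono) simp
      moreover have "2 ^ (N * N) / w n * exp (- (real n * real M * w n)) =
          2 ^ (N * N) * (1 / w n * exp (- (real n * real M * w n)))"
        by simp
      ultimately have sparse: "2 ^ (N * N) / w n * exp (- (real n * real M * w n)) \<le>
          2 ^ (N * N) * (real M / ln (real n))"
        by (simp only:)
      have "1 - bound n \<le> 1 - (2 * (1 - (1 - \<rho> n) ^ d) +
          2 * (real (N * N) * exp (- (real (n - 1) * w n))) +
          3 ^ d * w n + 2 ^ (N * N) / w n * exp (- (real n * real M * w n)))"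
        unfolding bound_def using sparse mult_left_mono[OF end_windows, of "real (N * N)"] by simp
      also have "\<dots> \<le> \<P>(v in (random_points n :: (nat \<Rightarrow> real ^ 'd) measure).
            graph_dist (geometric_graph p (r n) (v ` {1..n})) (v (i n)) (v (j n))
              \<le> ereal (K * norm (v (i n) - v (j n)) / r n))"
        using prob_graph_dist_ge[OF assms \<open>1 \<le> p\<close>, of "i n" n "j n" "s n" N M] elim M \<open>0 < s n\<close>
        unfolding r by (simp add: \<rho>_def w_def d_def \<omega>_def K_def N_def)
      finally show ?case .
    qed
    show ?thesis
    proof (rule tendsto_sandwich[OF lower _ bound_lim tendsto_const])
      show "\<forall>\<^sub>F n in sequentially. \<P>(v in (random_points n :: (nat \<Rightarrow> real ^ 'd) measure).
            graph_dist (geometric_graph p (r n) (v ` {1..n})) (v (i n)) (v (j n))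
              \<le> ereal (K * norm (v (i n) - v (j n)) / r n)) \<le> 1"
        by (intro always_eventually allI prob_space.prob_le_1[OF prob_space_random_points])
    qed
  qed
  ultimately show ?thesis
    by blast
qed

end
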